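(* Let $ABC$ be a triangle with side lengths $a=|BC|$, $b=|AC|$, $c=|AB|$ satisfying $a<b<c$. Then every minimum area isosceles container for $ABC$ is a special container of the first kind, or of the second kind, or of the third kind associated with $ABC$.
   Context: Triangles are non-degenerate closed triangular regions in the plane. An isosceles triangle is one with at least two sides of equal length. An isosceles container for a triangle $T$ is an isosceles triangle $T'$ with $T\subseteq T'$; it is a minimum area isosceles container if its area is at most that of every isosceles container for $T$. $\vec{XY}$ denotes the ray starting at $X$ and passing through $Y$. Let $ABC$ be a triangle with $a=|BC|<b=|AC|<c=|AB|$. Special containers of the first kind associated with $ABC$: the isosceles triangles $AB'C$, $ABC'$, $ABC''$, where $B'$ is the point on the ray $\vec{CB}$ with $|B'C|=|AC|=b$; $C'$ is the point on the ray $\vec{AC}$ with $|AC'|=c$; $C''$ is the point on the ray $\vec{BC}$ with $|BC''|=c$. Special containers of the second kind associated with $ABC$: the isosceles triangles $AB_1C$, $ABC_1$, $ABC_2$, where $B_1\ne A$ is the point on the ray $\vec{AB}$ with $|B_1C|=|AC|=b$; $C_1\neq A$ is the point on the ray $\vec{AC}$ with $|BC_1|=|AB|=c$; $C_2\ne B$ is the point on the ray $\vec{BC}$ with $|AC_2|=|AB|=c$. Special containers of the third kind associated with $ABC$: let $\overline{A}$ be the intersection of the perpendicular bisector of $BC$ with the line $AC$, $\overline{B}$ the intersection of the perpendicular bisector of $AC$ with the line $BC$, and $\overline{C}$ the intersection of the perpendicular bisector of $AB$ with the line $BC$ (when these points exist). The triangles $\overline{A}BC$, $A\overline{B}C$,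 $AB\overline{C}$ are called special containers of the third kind, provided that they contain $ABC$. (If $ABC$ is acute all three are special containers; otherwise only $AB\overline{C}$ is.) *)

theory Defs
  imports "HOL-Analysis.Analysis"
begin

definition isosceles_triangle :: "(real ^ 2) set \<Rightarrow> bool" where
  "isosceles_triangle S \<longleftrightarrow>
     (\<exists>P Q R. \<not> collinear {P, Q, R} \<and> S = convex hull {P, Q, R} \<and>
        (dist P Q = dist P R \<or> dist Q P = dist Q R \<or> dist R P = dist R Q))"

definition isosceles_container :: "(real ^ 2) set \<Rightarrow> (real ^ 2) set \<Rightarrow> bool" where
  "isosceles_container T S \<longleftrightarrow> isosceles_triangle S \<and> T \<subseteq> S"

definition minimum_area_isosceles_container :: "(real ^ 2) set \<Rightarrow> (real ^ 2) set \<Rightarrow> bool" where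
  "minimum_area_isosceles_container T S \<longleftrightarrow>
     isosceles_container T S \<and> (\<forall>S'. isosceles_container T S' \<longrightarrow> measure lborel S \<le> measure lborel S')"

definition ray :: "real ^ 2 \<Rightarrow> real ^ 2 \<Rightarrow> (real ^ 2) set" where
  "ray X Y = {X + t *\<^sub>R (Y - X) | t. t \<ge> 0}"

definition perpendicular_bisector :: "real ^ 2 \<Rightarrow> real ^ 2 \<Rightarrow> (real ^ 2) set" where
  "perpendicular_bisector X Y = {P. orthogonal (P - midpoint X Y) (Y - X)}"

text \<open>
  The special containers of \<open>ABC\<close> are only meant for \<open>|BC| < |AC| < |AB|\<close>. The three
  disjuncts below are, in order, the triangles \<open>AB'C\<close>, \<open>ABC'\<close>, \<open>ABC''\<close> (first kind),
  \<open>AB\<^sub>1C\<close>, \<open>ABC\<^sub>1\<close>, \<open>ABC\<^sub>2\<close> (second kind), and those whose apex lies on the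
  perpendicular bisector of \<open>BC\<close>, \<open>AC\<close>, \<open>AB\<close> (third kind).
\<close>

definition special_container_first_kind ::
    "real ^ 2 \<Rightarrow> real ^ 2 \<Rightarrow> real ^ 2 \<Rightarrow> (real ^ 2) set \<Rightarrow> bool" where
  "special_container_first_kind A B C S \<longleftrightarrow>
     (\<exists>P. P \<in> ray C B \<and> dist P C = dist A C \<and> S = convex hull {A, P, C}) \<or>
     (\<exists>P. P \<in> ray A C \<and> dist A P = dist A B \<and> S = convex hull {A, B, P}) \<or>
     (\<exists>P. P \<in> ray B C \<and> dist B P = dist A B \<and> S = convex hull {A, B, P})"

definition special_container_second_kind ::
    "real ^ 2 \<Rightarrow> real ^ 2 \<Rightarrow> real ^ 2 \<Rightarrow> (real ^ 2) set \<Rightarrow> bool" where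
  "special_container_second_kind A B C S \<longleftrightarrow>
     (\<exists>P. P \<in> ray A B \<and> P \<noteq> A \<and> dist P C = dist A C \<and> S = convex hull {A, P, C}) \<or>
     (\<exists>P. P \<in> ray A C \<and> P \<noteq> A \<and> dist B P = dist A B \<and> S = convex hull {A, B, P}) \<or>
     (\<exists>P. P \<in> ray B C \<and> P \<noteq> B \<and> dist A P = dist A B \<and> S = convex hull {A, B, P})"

text \<open>
  For \<open>X \<noteq> Y\<close>, a line through \<open>X\<close> or \<open>Y\<close> meets the perpendicular bisector of \<open>XY\<close> in at most
  one point (and in none if it is perpendicular to \<open>XY\<close>), so each \<open>P\<close> below is unique
  if it exists.
\<close>

definition special_container_third_kind ::
    "real ^ 2 \<Rightarrow> real ^ 2 \<Rightarrow> real ^ 2 \<Rightarrow> (real ^ 2) set \<Rightarrow> bool" where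
  "special_container_third_kind A B C S \<longleftrightarrow>
     convex hull {A, B, C} \<subseteq> S \<and>
     ((\<exists>P. P \<in> perpendicular_bisector B C \<inter> affine hull {A, C} \<and> S = convex hull {P, B, C}) \<or>
      (\<exists>P. P \<in> perpendicular_bisector A C \<inter> affine hull {B, C} \<and> S = convex hull {A, P, C}) \<or>
      (\<exists>P. P \<in> perpendicular_bisector A B \<inter> affine hull {B, C} \<and> S = convex hull {A, B, P}))"

end

(*
  A minimum area container S has a side through two vertices of the triangle: otherwise an
  infinitesimal rotation in one of the two senses, followed by a translation, keeps the triangle
  inside S while scaling it by a factor > 1. Put this side on the x-axis, write the triangle as
  (x,0), (y,0), (z,h), and let sg, tau be the cotangents of the two angles of S on that axis. The
  best S of given shape spans [min x (z - tau h), max y (z + sg h)], so its area is an explicit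
  function of the shape alone, with three or four regimes. If neither x = z - tau h nor
  y = z + sg h, the shape is a local minimum inside a regime, and the derivative vanishes. This
  is either impossible or leaves a critical shape whose area exceeds that of a container of the
  first or second kind. At the regime boundaries S is a special container.
*)
theory Submission
  imports Defs
begin

section \<open>Triangles in the plane\<close>

text \<open>Why a small rotation always gains: moving every vertex \<open>V\<close> in a straight
  line for a time \<open>t\<close> with velocity \<open>i V + w\<close> is multiplication by
  \<open>1 + t i\<close> plus a translation, hence exactly a similarity of ratio
  \<open>sqrt (1 + t^2)\<close>. Barycentric coordinates with respect to S are affine in
  \<open>t\<close> along this motion, so a vertex on a side stays in S once its coordinate there has
  nonnegative velocity, zero included. The coordinate velocities caused by a translation sum to zero
  and are otherwise arbitrary. With at most one vertex per side, only the sum of three rotational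
  velocities matters, and reversing the rotation changes its sign. Why calculus alone does not
  settle the shape: with a leg on the axis, a stationary shape inside a regime can be a genuine
  local minimum, and only a container in another position beats it. The first kind supplies a family
  of these, since both sides at a vertex may be stretched to any sufficiently large common length.
  Taking the leg of S for that length cancels it and leaves a comparison of the sines of two apex
  angles.\<close>

definition det3 :: "real ^ 2 \<Rightarrow> real ^ 2 \<Rightarrow> real ^ 2 \<Rightarrow> real" where
  "det3 P Q R = (Q $ 1 - P $ 1) * (R $ 2 - P $ 2) - (Q $ 2 - P $ 2) * (R $ 1 - P $ 1)"

lemma measure_triangle: "measure lborel (convex hull {P, Q, R}) = \<bar>det3 P Q R\<bar> / 2"
  by (simp add: content_triangle det3_def abs_minus_commute algebra_simps)

lemma det3_lincomb:
  assumes "u + v + w = 1"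
  shows "det3 (u *\<^sub>R P + v *\<^sub>R Q + w *\<^sub>R R) Q R = u * det3 P Q R"
    and "det3 P (u *\<^sub>R P + v *\<^sub>R Q + w *\<^sub>R R) R = v * det3 P Q R"
    and "det3 P Q (u *\<^sub>R P + v *\<^sub>R Q + w *\<^sub>R R) = w * det3 P Q R"
proof -
  have u: "u = 1 - v - w" using assms by simp
  show "det3 (u *\<^sub>R P + v *\<^sub>R Q + w *\<^sub>R R) Q R = u * det3 P Q R"
    "det3 P (u *\<^sub>R P + v *\<^sub>R Q + w *\<^sub>R R) R = v * det3 P Q R"
    "det3 P Q (u *\<^sub>R P + v *\<^sub>R Q + w *\<^sub>R R) = w * det3 P Q R"
    unfolding det3_def u by (simp_all add: algebra_simps)
qed

text \<open>Cramer's rule: the determinants on the right are the unnormalised barycentric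
  coordinates of \<open>V\<close>.\<close>

lemma det3_cramer:
  "det3 P Q R *\<^sub>R V = det3 V Q R *\<^sub>R P + det3 P V R *\<^sub>R Q + det3 P Q V *\<^sub>R R"
  by (simp add: vec_eq_iff forall_2 det3_def) (simp add: algebra_simps)

lemma det3_sum: "det3 V Q R + det3 P V R + det3 P Q V = det3 P Q R"
  by (simp add: det3_def algebra_simps)

text \<open>The quotients are the barycentric coordinates of \<open>V\<close>; dividing by the
  signed area makes the criterion independent of orientation.\<close>

lemma in_triangle_iff:
  assumes "det3 P Q R \<noteq> 0"
  shows "V \<in> convex hull {P, Q, R} \<longleftrightarrow>
    0 \<le> det3 V Q R / det3 P Q R \<and> 0 \<le> det3 P V R / det3 P Q R \<and> 0 \<le> det3 P Q V / det3 P Q R"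
proof
  assume "V \<in> convex hull {P, Q, R}"
  then obtain u v w where "0 \<le> u" "0 \<le> v" "0 \<le> w" "u + v + w = 1"
    "V = u *\<^sub>R P + v *\<^sub>R Q + w *\<^sub>R R"
    unfolding convex_hull_3 by auto
  then show "0 \<le> det3 V Q R / det3 P Q R \<and> 0 \<le> det3 P V R / det3 P Q R \<and> 0 \<le> det3 P Q V / det3 P Q R"
    using assms by (simp add: det3_lincomb)
next
  let ?D = "det3 P Q R"
  assume *: "0 \<le> det3 V Q R / ?D \<and> 0 \<le> det3 P V R / ?D \<and> 0 \<le> det3 P Q V / ?D"
  have "V = (1 / ?D) *\<^sub>R (?D *\<^sub>R V)" using assms by simp
  also have "\<dots> = (det3 V Q R / ?D) *\<^sub>R P + (det3 P V R / ?D) *\<^sub>R Q + (det3 P Q V / ?D) *\<^sub>R R"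
    unfolding det3_cramer[of P Q R V] by (simp add: scaleR_add_right)
  finally have "V = (det3 V Q R / ?D) *\<^sub>R P + (det3 P V R / ?D) *\<^sub>R Q + (det3 P Q V / ?D) *\<^sub>R R" .
  moreover have "det3 V Q R / ?D + det3 P V R / ?D + det3 P Q V / ?D = 1"
    using assms det3_sum[of V Q R P] by (simp flip: add_divide_distrib)
  ultimately show "V \<in> convex hull {P, Q, R}"
    unfolding convex_hull_3 using * by blast
qed

lemma collinear_iff_det3: "collinear {P, Q, R} \<longleftrightarrow> det3 P Q R = 0"
proof
  assume "collinear {P, Q, R}"
  then have "P = R \<or> (\<exists>u. Q = u *\<^sub>R P + (1 - u) *\<^sub>R R)"
    by (simp add: collinear_3_expand)
  then show "det3 P Q R = 0"
  proof
    assume "\<exists>u. Q = u *\<^sub>R P + (1 - u) *\<^sub>R R"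
    then obtain u where Q: "Q = u *\<^sub>R P + (1 - u) *\<^sub>R R" ..
    show ?thesis unfolding det3_def Q by (simp add: algebra_simps)
  qed (simp add: det3_def)
next
  assume *: "det3 P Q R = 0"
  have "P = Q \<or> (\<exists>u. R = u *\<^sub>R P + (1 - u) *\<^sub>R Q)"
  proof (cases "Q = P")
    case False
    let ?a = "Q $ 1 - P $ 1" and ?b = "Q $ 2 - P $ 2"
    define N where "N = ?a\<^sup>2 + ?b\<^sup>2"
    \<comment> \<open>Coefficient of the orthogonal projection of \<open>R - P\<close> on
      \<open>Q - P\<close>; a vanishing determinant makes \<open>R - P\<close> equal to that
      projection.\<close>
    define k where "k = ((R $ 1 - P $ 1) * ?a + (R $ 2 - P $ 2) * ?b) / N"
    have "N \<noteq> 0"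
      using False by (auto simp: N_def vec_eq_iff forall_2 sum_power2_eq_zero_iff)
    have "N * (R $ 1 - P $ 1) = ((R $ 1 - P $ 1) * ?a + (R $ 2 - P $ 2) * ?b) * ?a"
      "N * (R $ 2 - P $ 2) = ((R $ 1 - P $ 1) * ?a + (R $ 2 - P $ 2) * ?b) * ?b"
      using * unfolding N_def det3_def by algebra+
    then have "R $ 1 - P $ 1 = k * ?a" "R $ 2 - P $ 2 = k * ?b"
      using \<open>N \<noteq> 0\<close> by (simp_all add: k_def field_simps)
    then have "R = (1 - k) *\<^sub>R P + (1 - (1 - k)) *\<^sub>R Q"
      by (simp add: vec_eq_iff forall_2 algebra_simps)
    then show ?thesis by blast
  qed simp
  then have "collinear {P, R, Q}" by (simp add: collinear_3_expand)
  then show "collinear {P, Q, R}" by (simp add: insert_commute)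
qed

lemma dist_vec2:
  fixes P Q :: "real ^ 2"
  shows "(dist P Q)\<^sup>2 = (P $ 1 - Q $ 1)\<^sup>2 + (P $ 2 - Q $ 2)\<^sup>2"
  by (simp add: dist_norm norm_eq_sqrt_inner inner_vec_def sum_2 power2_eq_square)

section \<open>Upper bounds for the minimal area from comparison containers\<close>

lemma minimum_area_le:
  assumes "minimum_area_isosceles_container (convex hull {X, Y, Z}) S"
    and "det3 P Q R \<noteq> 0" "dist P Q = dist P R"
    and "X \<in> convex hull {P, Q, R}" "Y \<in> convex hull {P, Q, R}" "Z \<in> convex hull {P, Q, R}"
  shows "2 * measure lborel S \<le> \<bar>det3 P Q R\<bar>"
proof -
  have "isosceles_triangle (convex hull {P, Q, R})"
    unfolding isosceles_triangle_def using assms(2,3) by (metis collinear_iff_det3)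
  moreover have "convex hull {X, Y, Z} \<subseteq> convex hull {P, Q, R}"
    using assms(4-6) by (intro hull_minimal) auto
  ultimately show ?thesis
    using assms(1) measure_triangle[of P Q R]
    unfolding minimum_area_isosceles_container_def isosceles_container_def by fastforce
qed

lemma in_convex_extend:
  fixes X :: "'a :: real_vector"
  assumes "k \<ge> 1" "W = X + k *\<^sub>R (Y - X)" "X \<in> S" "W \<in> S" "convex S"
  shows "Y \<in> S"
proof -
  have "Y = (1 - 1 / k) *\<^sub>R X + (1 / k) *\<^sub>R W"
    using assms(1) by (simp add: assms(2) algebra_simps)
  with assms show ?thesis by (auto intro!: convexD)
qed

text \<open>Stretching both sides at \<open>X\<close> to the common length \<open>n\<close> keeps
  the angle there, so the doubled area is \<open>n^2\<close> times its sine. \<open>n\<close> is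
  left free so that it can be matched with the leg of a rival container.\<close>

lemma area_le_first_kind:
  assumes "minimum_area_isosceles_container (convex hull {X, Y, Z}) S"
    and "det3 X Y Z \<noteq> 0" and n: "dist X Y \<le> n" "dist X Z \<le> n"
  shows "2 * measure lborel S \<le> n\<^sup>2 * \<bar>det3 X Y Z\<bar> / (dist X Y * dist X Z)"
proof -
  define j k where "j = n / dist X Y" and "k = n / dist X Z"
  define Q R where "Q = X + j *\<^sub>R (Y - X)" and "R = X + k *\<^sub>R (Z - X)"
  have pos: "dist X Y > 0" "dist X Z > 0"
    using assms(2) by (auto simp: det3_def)
  then have "n > 0" using n by linarith
  have jk: "j \<ge> 1" "k \<ge> 1" using pos n by (simp_all add: j_def k_def)
  have det: "det3 X Q R = j * k * det3 X Y Z"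
    by (simp add: det3_def Q_def R_def algebra_simps)
  have "dist X Q = n" "dist X R = n"
    using pos \<open>n > 0\<close> by (simp_all add: Q_def R_def j_def k_def dist_norm norm_minus_commute)
  then have "2 * measure lborel S \<le> \<bar>det3 X Q R\<bar>"
    using assms(2) jk by (intro minimum_area_le[OF assms(1)])
      (auto simp: det intro: in_convex_extend[OF _ Q_def] in_convex_extend[OF _ R_def] hull_inc)
  also have "\<dots> = n\<^sup>2 * \<bar>det3 X Y Z\<bar> / (dist X Y * dist X Z)"
    using jk by (simp add: det abs_mult) (simp add: j_def k_def power2_eq_square)
  finally show ?thesis .
qed

text \<open>The container has apex \<open>X\<close>, one leg \<open>XZ\<close>, and its third vertex
  on the ray from \<open>Z\<close> through \<open>Y\<close>. Stretching the side \<open>ZY\<close>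
  by \<open>k\<close> multiplies the area by \<open>k\<close>.\<close>

lemma area_le_second_kind:
  assumes "minimum_area_isosceles_container (convex hull {X, Y, Z}) S"
    and "det3 X Y Z \<noteq> 0" "k \<ge> 1" "dist X (Z + k *\<^sub>R (Y - Z)) = dist X Z"
  shows "2 * measure lborel S \<le> k * \<bar>det3 X Y Z\<bar>"
proof -
  define R where "R = Z + k *\<^sub>R (Y - Z)"
  have det: "det3 X Z R = - (k * det3 X Y Z)"
    by (simp add: det3_def R_def algebra_simps)
  have "2 * measure lborel S \<le> \<bar>det3 X Z R\<bar>"
    using assms(2-4) by (intro minimum_area_le[OF assms(1)])
      (auto simp: det R_def[symmetric] intro: in_convex_extend[OF _ R_def] hull_inc)
  then show ?thesis using assms(3) by (simp add: det abs_mult)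
qed

section \<open>One-parameter minimisation\<close>

text \<open>Every area below is a squared length over a shape factor; this is the vanishing of its
  derivative, with the nonzero factor \<open>L s\<close> cancelled.\<close>

lemma local_min_square_over:
  fixes L g :: "real \<Rightarrow> real"
  assumes L: "(L has_real_derivative L') (at s)" and g: "(g has_real_derivative g') (at s)"
    and pos: "g s > 0" "L s > 0"
    and min: "\<forall>\<^sub>F r in nhds s. (L s)\<^sup>2 / g s \<le> (L r)\<^sup>2 / g r"
  shows "2 * L' * g s = L s * g'"
proof -
  obtain d where d: "d > 0" "\<And>r. \<bar>s - r\<bar> < d \<Longrightarrow> (L s)\<^sup>2 / g s \<le> (L r)\<^sup>2 / g r"
    using min unfolding eventually_nhds_metric by (auto simp: dist_real_def abs_minus_commute)
  have "((\<lambda>r. (L r)\<^sup>2 / g r) has_real_derivative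
      (2 * L s * L' * g s - (L s)\<^sup>2 * g') / (g s)\<^sup>2) (at s)"
    using pos by (auto intro!: derivative_eq_intros L g simp: power2_eq_square)
  then have "(2 * L s * L' * g s - (L s)\<^sup>2 * g') / (g s)\<^sup>2 = 0"
    using d by (intro DERIV_local_min) auto
  then have "L s * (2 * L' * g s - L s * g') = 0"
    using pos by (simp add: power2_eq_square algebra_simps)
  then show ?thesis using pos by simp
qed

lemma divide_le_divide_iff:
  fixes a b c d :: real
  assumes "b > 0" "d > 0"
  shows "a / b \<le> c / d \<longleftrightarrow> a * d \<le> c * b"
  using assms by (simp add: field_simps)

text \<open>
  Here \<open>s\<close> and \<open>tau s\<close> are the cotangents of the base angle and of the apex angle of an isosceles
  triangle with a leg on the axis, so \<open>(q - p)\<^sup>2 / (s + tau s)\<close> is twice its area. Critical shapes that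
  are not minimal do exist; the last three assumptions exclude them by comparison with containers
  whose apex is at \<open>(x, 0)\<close> or \<open>(y, 0)\<close>.
\<close>

lemma leg_optimum:
  fixes x y z h p q s :: real
  defines "tau \<equiv> \<lambda>s::real. (1 / s - s) / 2"
  assumes "x < y" "h > 0" "s > 0" "p < q"
    and feas: "p \<le> x" "y \<le> q" "z + s * h \<le> q" "p \<le> z - tau s * h"
    and opt: "\<And>p' q' s'. \<lbrakk>s' > 0; p' < q'; p' \<le> x; y \<le> q'; z + s' * h \<le> q'; p' \<le> z - tau s' * h\<rbrakk>
      \<Longrightarrow> (q - p)\<^sup>2 / (s + tau s) \<le> (q' - p')\<^sup>2 / (s' + tau s')"
    and apexX: "\<And>n. \<lbrakk>y - x \<le> n; sqrt ((z - x)\<^sup>2 + h\<^sup>2) \<le> n\<rbrakk>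
      \<Longrightarrow> (q - p)\<^sup>2 / (s + tau s) \<le> n\<^sup>2 * h / sqrt ((z - x)\<^sup>2 + h\<^sup>2)"
    and apexY: "\<And>n. \<lbrakk>y - x \<le> n; sqrt ((z - y)\<^sup>2 + h\<^sup>2) \<le> n\<rbrakk>
      \<Longrightarrow> (q - p)\<^sup>2 / (s + tau s) \<le> n\<^sup>2 * h / sqrt ((z - y)\<^sup>2 + h\<^sup>2)"
    and second: "\<lbrakk>z \<le> x; y < z + h\<rbrakk> \<Longrightarrow> (q - p)\<^sup>2 / (s + tau s) \<le>
      2 * (h\<^sup>2 + (x - z) * (y - z)) / (h\<^sup>2 + (y - z)\<^sup>2) * (h * (y - x))"
  shows "p = min x (z - tau s * h)" "q = max y (z + s * h)"
    and "x = z - tau s * h \<or> y = z + s * h"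
proof -
  have g_eq: "s + tau s = (s\<^sup>2 + 1) / (2 * s)" if "s > 0" for s
    using that by (simp add: tau_def field_simps power2_eq_square)
  have g_pos: "s + tau s > 0" if "s > 0" for s
    using that by (simp add: g_eq add_nonneg_pos)
  let ?A = "(q - p)\<^sup>2 / (s + tau s)"
  define l where "l s = max y (z + s * h) - min x (z - tau s * h)" for s
  have l_pos: "l s > 0" for s
    using \<open>x < y\<close> by (simp add: l_def max_def min_def)
  have "q - p \<ge> l s" using feas by (simp add: l_def)
  have l_opt: "?A \<le> (l s')\<^sup>2 / (s' + tau s')" if "s' > 0" for s'
    using opt[of s' "min x (z - tau s' * h)" "max y (z + s' * h)"] that l_pos[of s']
    by (simp add: l_def)
  from this[OF \<open>s > 0\<close>] have "(q - p)\<^sup>2 \<le> (l s)\<^sup>2"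
    using g_pos[OF \<open>s > 0\<close>] by (simp add: divide_le_cancel)
  then have "q - p = l s"
    using \<open>q - p \<ge> l s\<close> l_pos[of s] by (metis abs_le_square_iff abs_of_pos antisym order_less_le_trans)
  then show p: "p = min x (z - tau s * h)" and q: "q = max y (z + s * h)"
    using feas by (auto simp: l_def)
  have tau_s: "tau s * (2 * s) = 1 - s\<^sup>2"
    using \<open>s > 0\<close> by (simp add: tau_def field_simps power2_eq_square)
  have dtau: "(tau has_real_derivative (- 1 / s\<^sup>2 - 1) / 2) (at s)"
    unfolding tau_def using \<open>s > 0\<close> by (auto intro!: derivative_eq_intros simp: power2_eq_square)
  have dg: "((\<lambda>s. s + tau s) has_real_derivative (1 - 1 / s\<^sup>2) / 2) (at s)"
    by (auto intro!: derivative_eq_intros dtau simp: field_simps)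
  have cont: "(tau \<longlongrightarrow> tau s) (nhds s)"
    using DERIV_isCont[OF dtau] by (simp add: isCont_def tendsto_at_iff_tendsto_nhds)
  have id: "((\<lambda>r. r) \<longlongrightarrow> s) (nhds s)" by (rule filterlim_ident)
  have ev: "\<forall>\<^sub>F r in nhds s. r > 0"
    using order_tendstoD(1)[OF id \<open>s > 0\<close>] .
  \<comment> \<open>Away from the corner of \<open>min\<close> a single branch is active on a whole
    neighbourhood of \<open>s\<close>, so the length is differentiable there.\<close>
  have evX: "\<forall>\<^sub>F r in nhds s. min x (z - tau r * h) = (if x < z - tau s * h then x else z - tau r * h)"
    if "x \<noteq> z - tau s * h"
  proof -
    have *: "((\<lambda>r. z - tau r * h) \<longlongrightarrow> z - tau s * h) (nhds s)" by (intro tendsto_intros cont)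
    show ?thesis
      using order_tendstoD(1)[OF *, of x] order_tendstoD(2)[OF *, of x] that
      by (cases "x < z - tau s * h") (auto elim!: eventually_mono)
  qed
  have evY: "\<forall>\<^sub>F r in nhds s. max y (z + r * h) = (if y < z + s * h then z + r * h else y)"
    if "y \<noteq> z + s * h"
  proof -
    have *: "((\<lambda>r. z + r * h) \<longlongrightarrow> z + s * h) (nhds s)" by (intro tendsto_intros id)
    show ?thesis
      using order_tendstoD(1)[OF *, of y] order_tendstoD(2)[OF *, of y] that
      by (cases "y < z + s * h") (auto elim!: eventually_mono)
  qed
  show "x = z - tau s * h \<or> y = z + s * h"
  proof (rule ccontr)
    assume "\<not> ?thesis"
    then have ne: "x \<noteq> z - tau s * h" "y \<noteq> z + s * h" by auto
    define L where "L r = (if y < z + s * h then z + r * h else y)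
      - (if x < z - tau s * h then x else z - tau r * h)" for r
    have evL: "\<forall>\<^sub>F r in nhds s. r > 0 \<and> l r = L r"
      using ev evX[OF ne(1)] evY[OF ne(2)] by eventually_elim (simp add: l_def L_def)
    have Ls: "q - p = L s"
      using ne by (simp add: p q L_def)
    have loc: "\<forall>\<^sub>F r in nhds s. (L s)\<^sup>2 / (s + tau s) \<le> (L r)\<^sup>2 / (r + tau r)"
      using evL by eventually_elim (metis l_opt Ls)
    have A: "?A = (q - p)\<^sup>2 * (2 * s) / (s\<^sup>2 + 1)"
      using \<open>s > 0\<close> by (simp add: g_eq)
    consider (both) "y > z + s * h" "x < z - tau s * h" | (left) "y < z + s * h" "x < z - tau s * h"
      | (right) "y > z + s * h" "x > z - tau s * h" | (none) "y < z + s * h" "x > z - tau s * h"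
      using ne by linarith
    then show False
    proof cases
      \<comment> \<open>The length is constant, while the denominator
        \<open>s + tau s = (s + 1 / s) / 2\<close> is least at 1; moving \<open>s\<close> away from
        1 therefore lowers the area strictly.\<close>
      case both
      obtain d where d: "d > 0" "\<And>r. \<bar>r - s\<bar> < d \<Longrightarrow> r > 0 \<and> l r = y - x"
        using evL both unfolding eventually_nhds_metric L_def by (auto simp: dist_real_def)
      define r where "r = (if s \<le> 1 then s - d / 2 else s + d / 2)"
      have r: "r > 0" "l r = y - x" using d by (auto simp: r_def)
      have "q - p = y - x" using both by (simp add: p q)
      then have "(y - x)\<^sup>2 * (1 / (s + tau s)) \<le> (y - x)\<^sup>2 * (1 / (r + tau r))"
        using l_opt[OF r(1)] r(2) by simp
      then have "1 / (s + tau s) \<le> 1 / (r + tau r)"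
        using \<open>x < y\<close> by (simp only: mult_le_cancel_left_pos zero_less_power diff_gt_0_iff_gt)
      then have "r + tau r \<le> s + tau s"
        using g_pos[OF r(1)] g_pos[OF \<open>s > 0\<close>] by (simp add: field_simps)
      \<comment> \<open>The difference \<open>(r + 1 / r) - (s + 1 / s)\<close> is this product
        divided by \<open>r * s\<close>.\<close>
      then have "(s - r) * (1 - s * r) \<le> 0"
        using r(1) \<open>s > 0\<close> by (simp add: g_eq field_simps power2_eq_square)
      moreover have "(s - r) * (1 - s * r) > 0"
      proof (cases "s \<le> 1")
        case True
        then have "r < s" using d(1) by (simp add: r_def)
        moreover have "s * r \<le> 1 * r" using True r(1) by (intro mult_right_mono) auto
        ultimately show ?thesis using True by simp
      next
        case False
        then have "r > s" using d(1) by (simp add: r_def)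
        moreover have "s * r > 1" using False \<open>r > s\<close> by (simp add: less_1_mult)
        ultimately show ?thesis by (simp add: mult_neg_neg)
      qed
      ultimately show False by simp
    next
      \<comment> \<open>The apex of S is \<open>(x, 0)\<close>, and \<open>(z, h)\<close> lies on
        the line of the side through \<open>q\<close>, opposite the apex. Stationarity forces an
        obtuse apex angle (\<open>s > 1\<close>) and \<open>u > h * s\<close>.\<close>
      case left
      define u where "u = z - x"
      have L: "L = (\<lambda>r. z + r * h - x)" using left by (simp add: L_def fun_eq_iff)
      have ell: "q - p = u + h * s" using left by (simp add: p q u_def algebra_simps)
      have "(L has_real_derivative h) (at s)"
        unfolding L by (auto intro!: derivative_eq_intros)
      from local_min_square_over[OF this dg _ _ loc]
      have "2 * h * (s + tau s) = L s * ((1 - 1 / s\<^sup>2) / 2)"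
        using g_pos \<open>s > 0\<close> \<open>p < q\<close> Ls by simp
      then have "2 * s\<^sup>2 * (2 * h * (s + tau s)) = 2 * s\<^sup>2 * ((u + h * s) * ((1 - 1 / s\<^sup>2) / 2))"
        using Ls ell by simp
      also have "2 * s\<^sup>2 * (2 * h * (s + tau s)) = 2 * h * (s\<^sup>2 + 1) * s"
        using \<open>s > 0\<close> by (simp add: g_eq field_simps power2_eq_square)
      also have "2 * s\<^sup>2 * ((u + h * s) * ((1 - 1 / s\<^sup>2) / 2)) = (u + h * s) * (s\<^sup>2 - 1)"
        using \<open>s > 0\<close> by (simp add: field_simps power2_eq_square)
      finally have "2 * h * (s\<^sup>2 + 1) * s = (u + h * s) * (s\<^sup>2 - 1)" .
      then have crit: "u * (s\<^sup>2 - 1) = h * s * (s\<^sup>2 + 3)"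
        by (simp add: algebra_simps power2_eq_square)
      have u_tau: "u > tau s * h" using left by (simp add: u_def)
      have "s > 1"
      proof (rule ccontr)
        assume "\<not> s > 1"
        then have "s\<^sup>2 \<le> 1" using \<open>s > 0\<close> by (simp add: power_le_one)
        then have "tau s * h \<ge> 0" using \<open>s > 0\<close> \<open>h > 0\<close> tau_s
          by (smt (verit) mult_nonneg_nonneg mult_neg_pos)
        then have "u * (s\<^sup>2 - 1) \<le> 0" using u_tau \<open>s\<^sup>2 \<le> 1\<close> by (simp add: mult_nonneg_nonpos)
        moreover have "h * s * (s\<^sup>2 + 3) > 0" using \<open>s > 0\<close> \<open>h > 0\<close> by (simp add: add_nonneg_pos)
        ultimately show False using crit by simp
      qed
      then have "s\<^sup>2 > 1" by (simp add: one_less_power)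
      have "(u - h * s) * (s\<^sup>2 - 1) = 4 * h * s" using crit by (simp add: algebra_simps)
      then have "u > h * s"
        using \<open>s\<^sup>2 > 1\<close> \<open>s > 0\<close> \<open>h > 0\<close> by (smt (verit) mult_nonpos_nonneg mult_pos_pos)
      define r where "r = sqrt (u\<^sup>2 + h\<^sup>2)"
      have r2: "r\<^sup>2 = u\<^sup>2 + h\<^sup>2" by (simp add: r_def)
      have "r > 0" using \<open>h > 0\<close> by (simp add: r_def add_nonneg_pos)
      have "u > 0" using \<open>u > h * s\<close> \<open>h > 0\<close> \<open>s > 0\<close> by (smt (verit) mult_pos_pos)
      have "r \<ge> u" using r2 \<open>r > 0\<close> by (simp add: r_def)
      have hs: "h * s > h" using \<open>s > 1\<close> \<open>h > 0\<close> by simp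
      have "h\<^sup>2 \<le> (h * s)\<^sup>2" using hs \<open>h > 0\<close> by (intro power_mono) auto
      moreover have "0 \<le> 2 * u * (h * s)" using \<open>u > 0\<close> \<open>h > 0\<close> \<open>s > 0\<close> by simp
      ultimately have "r\<^sup>2 \<le> (u + h * s)\<^sup>2"
        using r2 unfolding power2_sum by linarith
      then have "r \<le> q - p"
        unfolding ell[symmetric] by (rule power2_le_imp_le) (use \<open>p < q\<close> in simp)
      moreover have "y - x \<le> q - p" using feas by simp
      \<comment> \<open>Taking \<open>n\<close> equal to the leg of S reduces the comparison to
        \<open>h / r\<close> against \<open>2 * s / (s\<^sup>2 + 1)\<close>, the sines of the angle
        of the triangle at \<open>(x, 0)\<close> and of the apex angle of S. But
        \<open>h / r < 1 / s\<close>, which is below the second sine because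
        \<open>s > 1\<close>.\<close>
      ultimately have "?A \<le> (q - p)\<^sup>2 * h / r"
        using apexX[of "q - p"] unfolding r_def u_def by blast
      then have "(q - p)\<^sup>2 * (2 * s) * r \<le> (q - p)\<^sup>2 * h * (s\<^sup>2 + 1)"
        unfolding A using \<open>r > 0\<close> by (subst (asm) divide_le_divide_iff) (auto intro: add_nonneg_pos)
      then have "(q - p)\<^sup>2 * (2 * s * r) \<le> (q - p)\<^sup>2 * (h * (s\<^sup>2 + 1))"
        by (simp only: mult.assoc)
      then have "2 * s * r \<le> h * (s\<^sup>2 + 1)" using \<open>p < q\<close> by simp
      moreover have "s * r > s * (h * s)" using \<open>s > 0\<close> \<open>r \<ge> u\<close> \<open>u > h * s\<close> by simp
      moreover have "h * s\<^sup>2 > h" using \<open>s\<^sup>2 > 1\<close> \<open>h > 0\<close> by simp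
      ultimately show False by (simp add: power2_eq_square algebra_simps)
    next
      \<comment> \<open>Now \<open>q = y\<close>, and \<open>(z, h)\<close> lies on the line of the
        leg through the apex \<open>p\<close>. The rival has its apex at \<open>(y, 0)\<close> and
        again legs of length \<open>q - p\<close>.\<close>
      case right
      define v where "v = y - z"
      have L: "L = (\<lambda>r. y - (z - tau r * h))" using right by (simp add: L_def fun_eq_iff)
      have ell: "q - p = v + h * tau s" using right by (simp add: p q v_def algebra_simps)
      have "(L has_real_derivative (- 1 / s\<^sup>2 - 1) / 2 * h) (at s)"
        unfolding L by (auto intro!: derivative_eq_intros dtau)
      from local_min_square_over[OF this dg _ _ loc]
      have "2 * ((- 1 / s\<^sup>2 - 1) / 2 * h) * (s + tau s) = L s * ((1 - 1 / s\<^sup>2) / 2)"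
        using g_pos \<open>s > 0\<close> \<open>p < q\<close> Ls by simp
      also have "L s = (2 * s * v + h * (1 - s\<^sup>2)) / (2 * s)"
        using ell Ls tau_s \<open>s > 0\<close> by (simp add: tau_def field_simps power2_eq_square)
      finally have "4 * s ^ 3 * (2 * ((- 1 / s\<^sup>2 - 1) / 2 * h) * (s + tau s)) =
        4 * s ^ 3 * ((2 * s * v + h * (1 - s\<^sup>2)) / (2 * s) * ((1 - 1 / s\<^sup>2) / 2))" by simp
      also have "4 * s ^ 3 * (2 * ((- 1 / s\<^sup>2 - 1) / 2 * h) * (s + tau s)) = - 2 * h * (s\<^sup>2 + 1)\<^sup>2"
        using \<open>s > 0\<close> by (simp add: g_eq field_simps power2_eq_square power3_eq_cube)
      also have "4 * s ^ 3 * ((2 * s * v + h * (1 - s\<^sup>2)) / (2 * s) * ((1 - 1 / s\<^sup>2) / 2)) =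
          (2 * s * v + h * (1 - s\<^sup>2)) * (s\<^sup>2 - 1)"
        using \<open>s > 0\<close> by (simp add: field_simps power2_eq_square power3_eq_cube)
      finally have crit: "2 * s * v * (1 - s\<^sup>2) = h * (1 + 6 * s\<^sup>2 + s ^ 4)"
        by algebra
      have "v > s * h" using right by (simp add: v_def)
      have "v > 0" using \<open>v > s * h\<close> \<open>h > 0\<close> \<open>s > 0\<close> by (smt (verit) mult_pos_pos)
      have rhs: "h * (1 + 6 * s\<^sup>2 + s ^ 4) > 0" using \<open>h > 0\<close> by (intro mult_pos_pos add_pos_nonneg) auto
      have "s\<^sup>2 < 1"
      proof (rule ccontr)
        assume "\<not> s\<^sup>2 < 1"
        then have "2 * s * v * (1 - s\<^sup>2) \<le> 0" using \<open>s > 0\<close> \<open>v > 0\<close> by (intro mult_nonneg_nonpos) auto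
        then show False using crit rhs by simp
      qed
      define r where "r = sqrt (v\<^sup>2 + h\<^sup>2)"
      have r2: "r\<^sup>2 = v\<^sup>2 + h\<^sup>2" by (simp add: r_def)
      have "r > v" using \<open>h > 0\<close> \<open>v > 0\<close> by (simp add: r_def real_less_rsqrt)
      \<comment> \<open>The estimates from here to \<open>r \<le> q - p\<close> ensure that a leg of
        length \<open>q - p\<close> is long enough to cover the side from \<open>(y, 0)\<close> to
        \<open>(z, h)\<close>.\<close>
      have "2 * s * v * (1 - s\<^sup>2) = 4 * (s\<^sup>2 * v * tau s)" 
        using tau_s by algebra
      then have "s\<^sup>2 * (4 * (v * tau s)) = h * (1 + 6 * s\<^sup>2 + s ^ 4)"
        using crit by algebra
      also have "\<dots> \<ge> h * (6 * s\<^sup>2)" using \<open>h > 0\<close> by (intro mult_left_mono) auto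
      finally have "s\<^sup>2 * (6 * h) \<le> s\<^sup>2 * (4 * (v * tau s))" by (simp add: mult.commute)
      then have "6 * h \<le> 4 * (v * tau s)" using \<open>s > 0\<close> by simp
      then have "h * h \<le> h * (2 * (v * tau s))" using \<open>h > 0\<close> by (intro mult_left_mono) auto
      then have "h\<^sup>2 \<le> 2 * v * (h * tau s)" by (simp add: power2_eq_square algebra_simps)
      then have "r\<^sup>2 \<le> (v + h * tau s)\<^sup>2"
        using r2 zero_le_power2[of "h * tau s"] unfolding power2_sum by linarith
      then have "r \<le> q - p"
        unfolding ell[symmetric] by (rule power2_le_imp_le) (use \<open>p < q\<close> in simp)
      moreover have "y - x \<le> q - p" using feas by simp
      ultimately have "?A \<le> (q - p)\<^sup>2 * h / r"
        using apexY[of "q - p"] unfolding r_def v_def power2_commute[of y z] by blast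
      then have "(q - p)\<^sup>2 * (2 * s) * r \<le> (q - p)\<^sup>2 * h * (s\<^sup>2 + 1)"
        unfolding A using \<open>r > v\<close> \<open>v > 0\<close> by (subst (asm) divide_le_divide_iff) (auto intro: add_nonneg_pos)
      then have "(q - p)\<^sup>2 * (2 * s * r) \<le> (q - p)\<^sup>2 * (h * (s\<^sup>2 + 1))"
        by (simp only: mult.assoc)
      then have "2 * s * r \<le> h * (s\<^sup>2 + 1)" using \<open>p < q\<close> by simp
      then have "2 * s * v < h * (s\<^sup>2 + 1)" using \<open>r > v\<close> \<open>s > 0\<close> by (smt (verit) mult_strict_left_mono)
      then have "2 * s * v * (1 - s\<^sup>2) < h * (s\<^sup>2 + 1) * (1 - s\<^sup>2)" using \<open>s\<^sup>2 < 1\<close> by simp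
      also have "\<dots> = h * (1 - s ^ 4)" by (simp add: algebra_simps power2_eq_square power4_eq_xxxx)
      also have "\<dots> \<le> h * (1 + 6 * s\<^sup>2 + s ^ 4)" using \<open>h > 0\<close> by simp
      finally show False using crit by simp
    next
      \<comment> \<open>Here \<open>(z, h)\<close> is the top vertex of S and the doubled area is
        \<open>h\<^sup>2 * (s + tau s)\<close>. This does have a minimum at \<open>s = 1\<close>,
        the right-angled shape with apex \<open>(z, 0)\<close>, so the second kind is needed to beat
        it.\<close>
      case none
      have L: "L = (\<lambda>r. (z + r * h) - (z - tau r * h))" using none by (simp add: L_def fun_eq_iff)
      have ell: "q - p = h * (s + tau s)" using none by (simp add: p q algebra_simps)
      have "(L has_real_derivative h * ((1 - 1 / s\<^sup>2) / 2)) (at s)"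
        unfolding L by (auto intro!: derivative_eq_intros dtau simp: field_simps)
      from local_min_square_over[OF this dg _ _ loc]
      have "2 * (h * ((1 - 1 / s\<^sup>2) / 2)) * (s + tau s) = L s * ((1 - 1 / s\<^sup>2) / 2)"
        using g_pos \<open>s > 0\<close> \<open>p < q\<close> Ls by simp
      then have eq: "2 * (h * ((1 - 1 / s\<^sup>2) / 2)) * (s + tau s) = h * (s + tau s) * ((1 - 1 / s\<^sup>2) / 2)"
        using Ls ell by simp
      have "h * k * g = 0" if "2 * (h * k) * g = h * g * k" for k g
        using that by simp
      from this[OF eq] have "h * ((1 - 1 / s\<^sup>2) / 2) * (s + tau s) = 0" .
      then have "s\<^sup>2 = 1" using g_pos[OF \<open>s > 0\<close>] \<open>h > 0\<close> \<open>s > 0\<close> by auto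
      then have "s = 1" using \<open>s > 0\<close> by (simp add: power2_eq_1_iff)
      then have "tau s = 0" by (simp add: tau_def)
      with none \<open>s = 1\<close> have ord: "z < x" "y < z + h" by auto
      define x' y' where "x' = x - z" and "y' = y - z"
      have xy: "0 < x'" "x' < y'" "y' < h" using ord \<open>x < y\<close> by (auto simp: x'_def y'_def)
      have "?A = h\<^sup>2" using \<open>s = 1\<close> \<open>tau s = 0\<close> ell by simp
      then have "h\<^sup>2 \<le> 2 * (h\<^sup>2 + x' * y') / (h\<^sup>2 + y'\<^sup>2) * (h * (y' - x'))"
        using second ord by (simp add: x'_def y'_def)
      then have "h\<^sup>2 * (h\<^sup>2 + y'\<^sup>2) \<le> h * (2 * (h\<^sup>2 + x' * y') * (y' - x'))"
        using \<open>h > 0\<close> by (simp add: field_simps add_pos_nonneg)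
      then have "h * (h\<^sup>2 + y'\<^sup>2) \<le> 2 * (h\<^sup>2 + x' * y') * (y' - x')"
        using \<open>h > 0\<close> by (simp add: power2_eq_square)
      \<comment> \<open>Both subtracted terms are positive because \<open>0 < x' < y' < h\<close>;
        dropping them leaves \<open>h * (h - y')\<^sup>2 < 0\<close>.\<close>
      also have "\<dots> = 2 * h\<^sup>2 * y' - 2 * x' * (h\<^sup>2 - y'\<^sup>2) - 2 * x'\<^sup>2 * y'"
        by (simp add: algebra_simps power2_eq_square)
      also have "\<dots> < 2 * h\<^sup>2 * y'"
      proof -
        have "y'\<^sup>2 < h\<^sup>2" using xy by (simp add: power_strict_mono)
        then show ?thesis using xy by (smt (verit) mult_pos_pos zero_less_power)
      qed
      finally have "h * (h - y')\<^sup>2 < 0" by (simp add: algebra_simps power2_eq_square)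
      then show False using \<open>h > 0\<close> by (simp add: mult_less_0_iff)
    qed
  qed
qed

text \<open>Both base angles have cotangent \<open>r\<close>, so the length is affine in each regime
  and stationarity reads \<open>L r = 2 * r * L'\<close>. Slope 0 would give length 0; slope
  \<open>h\<close> yields exactly one of the excluded flush equations; slope \<open>2 * h\<close>
  asks for \<open>4 * r * h\<close> where the length is \<open>2 * r * h\<close>. No comparison
  container is required.\<close>

lemma base_optimum:
  fixes x y z h p q r :: real
  assumes "x < y" "h > 0" "r > 0" "p < q"
    and feas: "p \<le> x" "y \<le> q" "z + r * h \<le> q" "p \<le> z - r * h"
    and opt: "\<And>p' q' r'. \<lbrakk>r' > 0; p' < q'; p' \<le> x; y \<le> q'; z + r' * h \<le> q'; p' \<le> z - r' * h\<rbrakk>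
      \<Longrightarrow> (q - p)\<^sup>2 / (r + r) \<le> (q' - p')\<^sup>2 / (r' + r')"
  shows "p = min x (z - r * h)" "q = max y (z + r * h)"
    and "x = z - r * h \<or> y = z + r * h"
proof -
  let ?A = "(q - p)\<^sup>2 / (r + r)"
  define l where "l s = max y (z + s * h) - min x (z - s * h)" for s
  have l_pos: "l s > 0" for s
    using \<open>x < y\<close> by (simp add: l_def max_def min_def)
  have "q - p \<ge> l r" using feas by (simp add: l_def)
  have l_opt: "?A \<le> (l s)\<^sup>2 / (s + s)" if "s > 0" for s
    using opt[of s "min x (z - s * h)" "max y (z + s * h)"] that l_pos[of s]
    by (simp add: l_def)
  from this[OF \<open>r > 0\<close>] have "(q - p)\<^sup>2 \<le> (l r)\<^sup>2"
    using \<open>r > 0\<close> by (simp add: divide_le_cancel)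
  then have "q - p = l r"
    using \<open>q - p \<ge> l r\<close> l_pos[of r] by (metis abs_le_square_iff abs_of_pos antisym order_less_le_trans)
  then show p: "p = min x (z - r * h)" and q: "q = max y (z + r * h)"
    using feas by (auto simp: l_def)
  have id: "((\<lambda>r. r) \<longlongrightarrow> r) (nhds r)" by (rule filterlim_ident)
  have ev: "\<forall>\<^sub>F s in nhds r. s > 0"
    using order_tendstoD(1)[OF id \<open>r > 0\<close>] .
  have evX: "\<forall>\<^sub>F s in nhds r. min x (z - s * h) = (if x < z - r * h then x else z - s * h)"
    if "x \<noteq> z - r * h"
  proof -
    have *: "((\<lambda>s. z - s * h) \<longlongrightarrow> z - r * h) (nhds r)" by (intro tendsto_intros id)
    show ?thesis
      using order_tendstoD(1)[OF *, of x] order_tendstoD(2)[OF *, of x] that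
      by (cases "x < z - r * h") (auto elim!: eventually_mono)
  qed
  have evY: "\<forall>\<^sub>F s in nhds r. max y (z + s * h) = (if y < z + r * h then z + s * h else y)"
    if "y \<noteq> z + r * h"
  proof -
    have *: "((\<lambda>s. z + s * h) \<longlongrightarrow> z + r * h) (nhds r)" by (intro tendsto_intros id)
    show ?thesis
      using order_tendstoD(1)[OF *, of y] order_tendstoD(2)[OF *, of y] that
      by (cases "y < z + r * h") (auto elim!: eventually_mono)
  qed
  show "x = z - r * h \<or> y = z + r * h"
  proof (rule ccontr)
    assume "\<not> ?thesis"
    then have ne: "x \<noteq> z - r * h" "y \<noteq> z + r * h" by auto
    define L where "L s = (if y < z + r * h then z + s * h else y)
      - (if x < z - r * h then x else z - s * h)" for s
    have evL: "\<forall>\<^sub>F s in nhds r. s > 0 \<and> l s = L s"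
      using ev evX[OF ne(1)] evY[OF ne(2)] by eventually_elim (simp add: l_def L_def)
    have Ls: "q - p = L r"
      using ne by (simp add: p q L_def)
    have loc: "\<forall>\<^sub>F s in nhds r. (L r)\<^sup>2 / (r + r) \<le> (L s)\<^sup>2 / (s + s)"
      using evL by eventually_elim (metis l_opt Ls)
    define L' where "L' = (if y < z + r * h then h else 0) + (if x < z - r * h then 0 else h)"
    have dL: "(L has_real_derivative L') (at r)"
      unfolding L_def L'_def by (auto intro!: derivative_eq_intros)
    have dg: "((\<lambda>s. s + s) has_real_derivative 2) (at r)"
      by (auto intro!: derivative_eq_intros)
    have "2 * L' * (r + r) = L r * 2"
      using \<open>r > 0\<close> \<open>p < q\<close> Ls by (intro local_min_square_over[OF dL dg _ _ loc]) auto
    then have "L r = 2 * r * L'" by (simp add: algebra_simps)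
    then show False
      using \<open>r > 0\<close> \<open>h > 0\<close> \<open>x < y\<close> ne unfolding L_def L'_def
      by (auto split: if_splits simp: algebra_simps)
  qed
qed

section \<open>Containers with a side on an axis\<close>

text \<open>
  The three alternatives are the three kinds of special containers, for an arbitrary labelling of the
  triangle: apex \<open>X\<close> and leg \<open>XY\<close> in the first two, base \<open>YZ\<close> in the third. The bound \<open>k \<ge> 1\<close>
  makes them containers, and determines the admissible labellings through the order of the sides.
\<close>

definition special_at :: "real ^ 2 \<Rightarrow> real ^ 2 \<Rightarrow> real ^ 2 \<Rightarrow> (real ^ 2) set \<Rightarrow> bool" where
  "special_at X Y Z S \<longleftrightarrow> (\<exists>k \<ge> 1.
    (let R = X + k *\<^sub>R (Z - X) in dist X R = dist X Y \<and> S = convex hull {X, Y, R}) \<or>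
    (let R = Y + k *\<^sub>R (Z - Y) in dist X R = dist X Y \<and> S = convex hull {X, Y, R}) \<or>
    (let P = Y + k *\<^sub>R (X - Y) in dist P Y = dist P Z \<and> S = convex hull {P, Y, Z}))"

lemma special_at_first:
  assumes "k \<ge> 1" "R = X + k *\<^sub>R (Z - X)" "dist X R = dist X Y" "S = convex hull {X, Y, R}"
  shows "special_at X Y Z S"
  using assms unfolding special_at_def Let_def by blast

lemma special_at_second:
  assumes "k \<ge> 1" "R = Y + k *\<^sub>R (Z - Y)" "dist X R = dist X Y" "S = convex hull {X, Y, R}"
  shows "special_at X Y Z S"
  using assms unfolding special_at_def Let_def by blast

lemma special_at_third:
  assumes "k \<ge> 1" "P = Y + k *\<^sub>R (X - Y)" "dist P Y = dist P Z" "S = convex hull {P, Y, Z}"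
  shows "special_at X Y Z S"
  using assms unfolding special_at_def Let_def by blast

text \<open>Cartesian coordinates with origin \<open>U\<close> and first axis \<open>(c, d)\<close>;
  the sign \<open>e\<close> may reverse orientation, so that a triangle of either orientation can be
  placed above its axis.\<close>

locale frame =
  fixes U :: "real ^ 2" and c d e :: real
  assumes cd: "c\<^sup>2 + d\<^sup>2 = 1" and e: "e\<^sup>2 = 1"
begin

definition pt :: "real \<Rightarrow> real \<Rightarrow> real ^ 2" where
  "pt x y = U + vector [c * x - e * d * y, d * x + e * c * y]"

lemma pt_nth: "pt x y $ 1 = U $ 1 + c * x - e * d * y" "pt x y $ 2 = U $ 2 + d * x + e * c * y"
  by (simp_all add: pt_def)

lemma pt_extend: "pt x y + k *\<^sub>R (pt x' y' - pt x y) = pt (x + k * (x' - x)) (y + k * (y' - y))"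
  by (simp add: vec_eq_iff forall_2 pt_nth algebra_simps)

lemma ptE: obtains x y where "V = pt x y"
proof
  let ?v = "V - U"
  have "c * (c * ?v $ 1 + d * ?v $ 2) - e * d * (e * (c * ?v $ 2 - d * ?v $ 1)) = ?v $ 1"
    "d * (c * ?v $ 1 + d * ?v $ 2) + e * c * (e * (c * ?v $ 2 - d * ?v $ 1)) = ?v $ 2"
    using cd e by algebra+
  then show "V = pt (c * ?v $ 1 + d * ?v $ 2) (e * (c * ?v $ 2 - d * ?v $ 1))"
    by (simp add: vec_eq_iff forall_2 pt_nth)
qed

lemma det3_pt:
  "det3 (pt x1 y1) (pt x2 y2) (pt x3 y3) = e * ((x2 - x1) * (y3 - y1) - (y2 - y1) * (x3 - x1))"
  unfolding det3_def pt_nth using cd by algebra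

lemma abs_e [simp]: "\<bar>e\<bar> = 1"
  using e by (simp add: abs_square_eq_1)

lemma e_nonzero [simp]: "e \<noteq> 0"
  using e by auto

lemma dist_pt: "dist (pt x y) (pt x' y') = sqrt ((x - x')\<^sup>2 + (y - y')\<^sup>2)"
proof -
  have "(dist (pt x y) (pt x' y'))\<^sup>2 = (x - x')\<^sup>2 + (y - y')\<^sup>2"
    unfolding dist_vec2 pt_nth using cd e by algebra
  then show ?thesis by (metis real_sqrt_unique zero_le_dist)
qed

text \<open>
  The triangle with base from \<open>(p, 0)\<close> to \<open>(q, 0)\<close> and base angles of cotangents \<open>tau\<close> at \<open>p\<close> and
  \<open>sg\<close> at \<open>q\<close>.
\<close>

definition height :: "real \<Rightarrow> real \<Rightarrow> real \<Rightarrow> real \<Rightarrow> real" where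
  "height p q sg tau = (q - p) / (sg + tau)"

definition tri_top :: "real \<Rightarrow> real \<Rightarrow> real \<Rightarrow> real \<Rightarrow> real ^ 2" where
  "tri_top p q sg tau = pt (p + tau * height p q sg tau) (height p q sg tau)"

lemma height_eq: "sg + tau > 0 \<Longrightarrow> (sg + tau) * height p q sg tau = q - p"
  by (simp add: height_def)

lemma tri_det:
  assumes "sg + tau > 0"
  shows "\<bar>det3 (pt p 0) (pt q 0) (tri_top p q sg tau)\<bar> = (q - p)\<^sup>2 / (sg + tau)"
  using assms by (simp add: tri_top_def det3_pt abs_mult height_def power2_eq_square)

text \<open>\<open>z + sg * h\<close> and \<open>z - tau * h\<close> are the points where the
  parallels to the right and left side through \<open>(z, h)\<close> meet the axis. This turns
  containment into bounds on the endpoints \<open>p\<close> and \<open>q\<close>.\<close>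

lemma in_tri_iff:
  assumes "sg + tau > 0" "p < q"
  shows "pt z h \<in> convex hull {pt p 0, pt q 0, tri_top p q sg tau} \<longleftrightarrow>
    0 \<le> h \<and> z + sg * h \<le> q \<and> p \<le> z - tau * h"
proof -
  define b where "b = height p q sg tau"
  have b: "b > 0" "(sg + tau) * b = q - p"
    using assms by (simp_all add: b_def height_def)
  let ?P = "pt p 0" and ?Q = "pt q 0" and ?R = "tri_top p q sg tau" and ?V = "pt z h"
  have R: "?R = pt (p + tau * b) b" by (simp add: tri_top_def b_def)
  have D: "det3 ?P ?Q ?R = e * ((q - p) * b)"
    by (simp add: R det3_pt)
  have V: "det3 ?V ?Q ?R = e * (b * (q - z - sg * h))"
    using b(2) unfolding R det3_pt by algebra
  have W: "det3 ?P ?V ?R = e * (b * (z - p - tau * h))"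
    unfolding R det3_pt by algebra
  have X: "det3 ?P ?Q ?V = e * ((q - p) * h)"
    by (simp add: det3_pt)
  show ?thesis
    using assms b(1) by (subst in_triangle_iff)
      (auto simp: D V W X zero_le_divide_iff zero_le_mult_iff mult_le_0_iff zero_less_mult_iff)
qed

end

lemma frame_exists:
  assumes "det3 P Q R \<noteq> 0"
  obtains U c d e l a b where "frame c d e" "l > 0" "b > 0"
    "P = frame.pt U c d e 0 0" "Q = frame.pt U c d e l 0" "R = frame.pt U c d e a b"
proof -
  define l where "l = dist P Q"
  have "l > 0" using assms by (auto simp: l_def det3_def)
  define c d e where "c = (Q $ 1 - P $ 1) / l" and "d = (Q $ 2 - P $ 2) / l" and "e = sgn (det3 P Q R)"
  have l2: "l\<^sup>2 = (Q $ 1 - P $ 1)\<^sup>2 + (Q $ 2 - P $ 2)\<^sup>2"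
    unfolding l_def by (subst dist_commute) (rule dist_vec2)
  have "c\<^sup>2 + d\<^sup>2 = l\<^sup>2 / l\<^sup>2"
    by (simp only: c_def d_def power_divide flip: add_divide_distrib l2)
  then have "c\<^sup>2 + d\<^sup>2 = 1" using \<open>l > 0\<close> by simp
  moreover have "e\<^sup>2 = 1" using assms by (simp add: e_def sgn_if)
  ultimately interpret frame P c d e by unfold_locales
  have "c * l = Q $ 1 - P $ 1" "d * l = Q $ 2 - P $ 2"
    using \<open>l > 0\<close> by (simp_all add: c_def d_def)
  then have P: "P = pt 0 0" and Q: "Q = pt l 0"
    by (simp_all add: vec_eq_iff forall_2 pt_nth)
  obtain a b where R: "R = pt a b" using ptE .
  have "det3 P Q R = e * (l * b)" using det3_pt[of 0 0 l 0 a b] by (simp flip: P Q R)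
  then have "sgn (l * b) > 0"
    using assms e_nonzero by (auto simp: e_def sgn_mult sgn_if split: if_splits)
  then have "b > 0" using \<open>l > 0\<close> by (simp add: sgn_mult)
  with \<open>l > 0\<close> P Q R frame_axioms that show thesis by blast
qed

section \<open>Optimal triangles on the axis are special containers\<close>

context frame begin

lemma tri_minimal:
  assumes "minimum_area_isosceles_container (convex hull {pt x 0, pt y 0, pt z h}) S"
    and "sg + tau > 0" "p < q" "h \<ge> 0" "x < y"
    and "p \<le> x" "y \<le> q" "z + sg * h \<le> q" "p \<le> z - tau * h"
    and "dist (pt p 0) (pt q 0) = dist (pt p 0) (tri_top p q sg tau) \<or>
      dist (tri_top p q sg tau) (pt p 0) = dist (tri_top p q sg tau) (pt q 0)"
  shows "2 * measure lborel S \<le> (q - p)\<^sup>2 / (sg + tau)"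
proof -
  let ?P = "pt p 0" and ?Q = "pt q 0" and ?R = "tri_top p q sg tau"
  have in_hull: "pt x 0 \<in> convex hull {?P, ?Q, ?R}" "pt y 0 \<in> convex hull {?P, ?Q, ?R}"
    "pt z h \<in> convex hull {?P, ?Q, ?R}"
    using assms by (simp_all add: in_tri_iff)
  have nz: "det3 ?P ?Q ?R \<noteq> 0"
    using tri_det[OF assms(2), of p q] assms(2,3) by auto
  have perm: "det3 ?R ?P ?Q = det3 ?P ?Q ?R" "{?R, ?P, ?Q} = {?P, ?Q, ?R}"
    by (auto simp: det3_def algebra_simps)
  have "2 * measure lborel S \<le> \<bar>det3 ?P ?Q ?R\<bar>"
    using assms(10)
  proof
    assume "dist ?P ?Q = dist ?P ?R"
    then show ?thesis using minimum_area_le[OF assms(1) nz] in_hull by blast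
  next
    assume "dist ?R ?P = dist ?R ?Q"
    then show ?thesis
      using minimum_area_le[OF assms(1), of ?R ?P ?Q] in_hull nz unfolding perm by blast
  qed
  then show ?thesis using tri_det[OF assms(2)] by simp
qed

text \<open>The apex angle at \<open>p\<close> is pi minus twice the base angle at \<open>q\<close>;
  the double angle formula gives its cotangent as \<open>(1 / s - s) / 2\<close>.\<close>

lemma leg_isosceles:
  assumes "s > 0" "p < q"
  shows "dist (pt p 0) (pt q 0) = dist (pt p 0) (tri_top p q s ((1 / s - s) / 2))"
proof -
  define t b where "t = (1 / s - s) / 2" and "b = height p q s t"
  have t: "2 * s * t = 1 - s\<^sup>2"
    using assms by (simp add: t_def field_simps power2_eq_square)
  have "s + t > 0" using assms by (simp add: t_def field_simps add_pos_pos)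
  then have "(q - p)\<^sup>2 = (s + t)\<^sup>2 * b\<^sup>2"
    using height_eq[of s t p q] by (simp add: b_def flip: power_mult_distrib)
  also have "(s + t)\<^sup>2 = t\<^sup>2 + 1" using t by algebra
  finally show ?thesis
    unfolding tri_top_def dist_pt t_def[symmetric] b_def[symmetric]
    by (simp add: power2_commute[of p q] power_mult_distrib ring_distribs)
qed

lemma base_isosceles:
  assumes "r > 0"
  shows "dist (tri_top p q r r) (pt p 0) = dist (tri_top p q r r) (pt q 0)"
proof -
  define b where "b = height p q r r"
  have "(r + r) * b = q - p" using height_eq[of r r] assms by (simp add: b_def)
  then have "(p + r * b - p)\<^sup>2 + (b - 0)\<^sup>2 = (p + r * b - q)\<^sup>2 + (b - 0)\<^sup>2"
    by algebra
  then show ?thesis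
    unfolding tri_top_def dist_pt b_def[symmetric] by simp
qed

lemma special_leg:
  fixes s :: real
  defines "tau \<equiv> (1 / s - s) / 2"
  assumes min: "minimum_area_isosceles_container (convex hull {pt x 0, pt y 0, pt z h}) S"
    and S: "S = convex hull {pt p 0, pt q 0, tri_top p q s tau}"
    and "s > 0" "p < q" "x < y" "h > 0"
    and feas: "p \<le> x" "y \<le> q" "z + s * h \<le> q" "p \<le> z - tau * h"
  shows "special_at (pt x 0) (pt y 0) (pt z h) S \<or> special_at (pt x 0) (pt z h) (pt y 0) S"
proof -
  let ?X = "pt x 0" and ?Y = "pt y 0" and ?Z = "pt z h" and ?R = "tri_top p q s tau"
  have g: "s + (1 / s - s) / 2 > 0" if "s > 0" for s :: real
    using that by (simp add: field_simps add_pos_pos)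
  have gs: "s + tau > 0" using g \<open>s > 0\<close> by (simp add: tau_def)
  have area: "2 * measure lborel S = (q - p)\<^sup>2 / (s + tau)"
    using tri_det[OF gs, of p q] measure_triangle S by (metis mult_2 field_sum_of_halves)
  have detT: "\<bar>det3 ?X ?Y ?Z\<bar> = h * (y - x)"
    using \<open>x < y\<close> \<open>h > 0\<close> by (simp add: det3_pt abs_mult)
  then have nz: "det3 ?X ?Y ?Z \<noteq> 0"
    using \<open>x < y\<close> \<open>h > 0\<close> by auto
  have XY: "dist ?X ?Y = y - x" "dist ?Y ?X = y - x"
    using \<open>x < y\<close> by (simp_all add: dist_pt)
  have XZ: "dist ?X ?Z = sqrt ((z - x)\<^sup>2 + h\<^sup>2)" "dist ?Y ?Z = sqrt ((z - y)\<^sup>2 + h\<^sup>2)"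
    by (simp_all add: dist_pt power2_commute)
  have opt: "(q - p)\<^sup>2 / (s + tau) \<le> (q' - p')\<^sup>2 / (s' + (1 / s' - s') / 2)"
    if "s' > 0" "p' < q'" "p' \<le> x" "y \<le> q'" "z + s' * h \<le> q'" "p' \<le> z - (1 / s' - s') / 2 * h"
    for p' q' s'
    using tri_minimal[OF min g[OF that(1)] that(2) _ \<open>x < y\<close> that(3-6)]
      leg_isosceles[OF that(1,2)] \<open>h > 0\<close> area by simp
  have apexX: "(q - p)\<^sup>2 / (s + tau) \<le> n\<^sup>2 * h / sqrt ((z - x)\<^sup>2 + h\<^sup>2)"
    if "y - x \<le> n" "sqrt ((z - x)\<^sup>2 + h\<^sup>2) \<le> n" for n
    using area_le_first_kind[OF min nz, of n] that \<open>x < y\<close> unfolding area detT XY XZ by simp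
  have apexY: "(q - p)\<^sup>2 / (s + tau) \<le> n\<^sup>2 * h / sqrt ((z - y)\<^sup>2 + h\<^sup>2)"
    if "y - x \<le> n" "sqrt ((z - y)\<^sup>2 + h\<^sup>2) \<le> n" for n
  proof -
    have "det3 ?Y ?X ?Z = - det3 ?X ?Y ?Z" by (simp add: det3_def algebra_simps)
    then have det': "\<bar>det3 ?Y ?X ?Z\<bar> = h * (y - x)" "det3 ?Y ?X ?Z \<noteq> 0" using detT nz by auto
    have "minimum_area_isosceles_container (convex hull {?Y, ?X, ?Z}) S"
      using min by (simp add: insert_commute)
    from area_le_first_kind[OF this det'(2), of n] show ?thesis
      using that \<open>x < y\<close> unfolding area det' XY XZ by simp
  qed
  have second: "(q - p)\<^sup>2 / (s + tau) \<le>
      2 * (h\<^sup>2 + (x - z) * (y - z)) / (h\<^sup>2 + (y - z)\<^sup>2) * (h * (y - x))"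
    if "z \<le> x" "y < z + h"
  proof -
    \<comment> \<open>This \<open>k\<close> sends \<open>Z\<close> to its mirror image in the foot
      of the perpendicular from \<open>X\<close> to the line \<open>ZY\<close>, hence to the other
      point of that line at distance \<open>|XZ|\<close> from \<open>X\<close>.\<close>
    define k where "k = 2 * (h\<^sup>2 + (x - z) * (y - z)) / (h\<^sup>2 + (y - z)\<^sup>2)"
    have N: "h\<^sup>2 + (y - z)\<^sup>2 > 0" using \<open>h > 0\<close> by (simp add: add_pos_nonneg)
    then have k: "k * (h\<^sup>2 + (y - z)\<^sup>2) = 2 * (h\<^sup>2 + (x - z) * (y - z))" by (simp add: k_def)
    have "(y - z)\<^sup>2 \<le> h\<^sup>2" using that \<open>x < y\<close> by (intro power_mono) auto
    moreover have "0 \<le> (x - z) * (y - z)" using that \<open>x < y\<close> by simp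
    ultimately have "1 \<le> k" using N by (simp add: k_def)
    moreover have "dist ?X (?Z + k *\<^sub>R (?Y - ?Z)) = dist ?X ?Z"
    proof -
      have "(x - (z + k * (y - z)))\<^sup>2 + (h + k * (0 - h))\<^sup>2 = (x - z)\<^sup>2 + h\<^sup>2"
        using k by algebra
      then show ?thesis unfolding pt_extend dist_pt by (simp add: power2_commute)
    qed
    ultimately show ?thesis
      using area_le_second_kind[OF min nz, of k] unfolding area detT k_def by blast
  qed
  note optimum = leg_optimum[OF \<open>x < y\<close> \<open>h > 0\<close> \<open>s > 0\<close> \<open>p < q\<close>, folded tau_def,
    OF feas opt apexX apexY second]
  have p: "p = min x (z - tau * h)" and q: "q = max y (z + s * h)"
    and flush: "x = z - tau * h \<or> y = z + s * h"
    using optimum by blast+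
  define b where "b = height p q s tau"
  have b: "(s + tau) * b = q - p" using height_eq[OF gs] by (simp add: b_def)
  have R: "?R = pt (p + tau * b) b" by (simp add: tri_top_def b_def)
  have "(s + tau) * h \<le> (s + tau) * b" unfolding b using feas by (simp add: algebra_simps)
  then have "h \<le> b" using gs by simp
  have iso: "dist (pt p 0) (pt q 0) = dist (pt p 0) ?R"
    unfolding tau_def by (rule leg_isosceles) fact+
  \<comment> \<open>In (1) and (3) the leg on the axis is \<open>XY\<close>, and \<open>Z\<close>
    lies on the side through \<open>X\<close> (first kind) or through \<open>Y\<close> (second
    kind). In (2) and (4) the length forces \<open>Z\<close> to be the top vertex: either the apex
    is \<open>X\<close> and \<open>Y\<close> lies on a leg (first kind), or the base is
    \<open>YZ\<close> and \<open>X\<close> lies on a leg (third kind).\<close>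
  consider (1) "x = z - tau * h" "p = x" "q = y" | (2) "x = z - tau * h" "p = x" "q = z + s * h" "y \<le> q"
    | (3) "y = z + s * h" "q = y" "p = x" | (4) "y = z + s * h" "q = y" "p = z - tau * h" "p \<le> x"
    using flush p q by (auto simp: min_def max_def split: if_splits)
  then show ?thesis
  proof cases
    case 1
    then have "z - x = tau * h" by simp
    then have "?R = ?X + (b / h) *\<^sub>R (?Z - ?X)"
      using \<open>h > 0\<close> 1(2) unfolding pt_extend R by (simp add: mult.commute)
    then have "special_at ?X ?Y ?Z S"
      using \<open>h \<le> b\<close> \<open>h > 0\<close> iso S 1(2,3) by (intro special_at_first[of "b / h" ?R]) auto
    then show ?thesis ..
  next
    case 2
    then have "(s + tau) * h = (s + tau) * b" unfolding b by (simp add: algebra_simps)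
    then have "b = h" using gs by simp
    then have RZ: "?R = ?Z" unfolding R using 2 \<open>b = h\<close> by simp
    have "pt q 0 = ?X + ((q - x) / (y - x)) *\<^sub>R (?Y - ?X)"
      using \<open>x < y\<close> unfolding pt_extend by simp
    moreover have "1 \<le> (q - x) / (y - x)" using 2(4) \<open>x < y\<close> by simp
    moreover have "dist ?X (pt q 0) = dist ?X ?Z" "S = convex hull {?X, ?Z, pt q 0}"
      using iso S unfolding RZ unfolding 2(2) by (auto simp: insert_commute)
    ultimately have "special_at ?X ?Z ?Y S" by (intro special_at_first)
    then show ?thesis ..
  next
    case 3
    then have Rx: "p + tau * b = y - s * b" using b by (simp add: algebra_simps)
    have "z - y = - (s * h)" using 3(1) by simp
    then have "?R = ?Y + (b / h) *\<^sub>R (?Z - ?Y)"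
      using \<open>h > 0\<close> unfolding pt_extend R Rx by (simp add: mult.commute)
    then have "special_at ?X ?Y ?Z S"
      using \<open>h \<le> b\<close> \<open>h > 0\<close> iso S 3(2,3) by (intro special_at_second[of "b / h" ?R]) auto
    then show ?thesis ..
  next
    case 4
    then have "(s + tau) * h = (s + tau) * b" unfolding b by (simp add: algebra_simps)
    then have "b = h" using gs by simp
    then have RZ: "?R = ?Z" unfolding R using 4 \<open>b = h\<close> by simp
    have "(y - p) / (y - x) * (x - y) = (y - p) / (y - x) * - (y - x)" by simp
    also have "\<dots> = - (y - p)" using \<open>x < y\<close> unfolding mult_minus_right by simp
    finally have "pt p 0 = ?Y + ((y - p) / (y - x)) *\<^sub>R (?X - ?Y)"
      unfolding pt_extend by simp
    moreover have "1 \<le> (y - p) / (y - x)" using 4(4) \<open>x < y\<close> by simp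
    moreover have "dist (pt p 0) ?Y = dist (pt p 0) ?Z" "S = convex hull {pt p 0, ?Y, ?Z}"
      using iso S unfolding RZ unfolding 4(2) by (auto simp: insert_commute)
    ultimately have "special_at ?X ?Y ?Z S" by (intro special_at_third)
    then show ?thesis ..
  qed
qed

lemma special_base:
  assumes min: "minimum_area_isosceles_container (convex hull {pt x 0, pt y 0, pt z h}) S"
    and S: "S = convex hull {pt p 0, pt q 0, tri_top p q r r}"
    and "r > 0" "p < q" "x < y" "h > 0"
    and feas: "p \<le> x" "y \<le> q" "z + r * h \<le> q" "p \<le> z - r * h"
  shows "special_at (pt z h) (pt x 0) (pt y 0) S \<or> special_at (pt z h) (pt y 0) (pt x 0) S"
proof -
  let ?X = "pt x 0" and ?Y = "pt y 0" and ?Z = "pt z h" and ?R = "tri_top p q r r"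
  have rr: "r + r > 0" using \<open>r > 0\<close> by simp
  have area: "2 * measure lborel S = (q - p)\<^sup>2 / (r + r)"
    unfolding S measure_triangle using tri_det[OF rr, of p q] by simp
  have opt: "(q - p)\<^sup>2 / (r + r) \<le> (q' - p')\<^sup>2 / (r' + r')"
    if "r' > 0" "p' < q'" "p' \<le> x" "y \<le> q'" "z + r' * h \<le> q'" "p' \<le> z - r' * h"
    for p' q' r'
    using tri_minimal[OF min _ that(2) _ \<open>x < y\<close> that(3-6)] that(1)
      base_isosceles[OF that(1), of p' q'] \<open>h > 0\<close> area by simp
  note optimum = base_optimum[OF \<open>x < y\<close> \<open>h > 0\<close> \<open>r > 0\<close> \<open>p < q\<close> feas opt]
  have p: "p = min x (z - r * h)" and q: "q = max y (z + r * h)"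
    and flush: "x = z - r * h \<or> y = z + r * h"
    using optimum by blast+
  define b where "b = height p q r r"
  have b: "2 * (r * b) = q - p" using height_eq[OF rr, of p q] by (simp add: b_def mult.assoc)
  have R: "?R = pt (p + r * b) b" by (simp add: tri_top_def b_def)
  have "r * h \<le> r * b" using feas b by simp
  then have "h \<le> b" using \<open>r > 0\<close> by simp
  have iso: "dist ?R (pt p 0) = dist ?R (pt q 0)"
    by (rule base_isosceles) fact+
  \<comment> \<open>In (1) and (3) the base is \<open>XY\<close> and \<open>Z\<close> lies on a leg,
    the third kind. In (2) and (4) \<open>Z\<close> is the apex and the base extends
    \<open>XY\<close> at one end, the second kind.\<close>
  consider (1) "x = z - r * h" "p = x" "q = y" | (2) "x = z - r * h" "p = x" "q = z + r * h" "y \<le> q"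
    | (3) "y = z + r * h" "q = y" "p = x" | (4) "y = z + r * h" "q = y" "p = z - r * h" "p \<le> x"
    using flush p q by (auto simp: min_def max_def split: if_splits)
  then show ?thesis
  proof cases
    case 1
    then have "z - x = r * h" by simp
    then have "?R = ?X + (b / h) *\<^sub>R (?Z - ?X)"
      using \<open>h > 0\<close> 1(2) unfolding pt_extend R by (simp add: mult.commute)
    then have "special_at ?Z ?X ?Y S"
      using \<open>h \<le> b\<close> \<open>h > 0\<close> iso S 1(2,3) by (intro special_at_third[of "b / h" ?R])
        (auto simp: insert_commute)
    then show ?thesis ..
  next
    case 2
    then have "r * b = r * h" using b by simp
    then have "b = h" using \<open>r > 0\<close> by simp
    then have RZ: "?R = ?Z" unfolding R using 2 \<open>b = h\<close> by simp
    have "pt q 0 = ?X + ((q - x) / (y - x)) *\<^sub>R (?Y - ?X)"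
      using \<open>x < y\<close> unfolding pt_extend by simp
    moreover have "1 \<le> (q - x) / (y - x)" using 2(4) \<open>x < y\<close> by simp
    moreover have "dist ?Z (pt q 0) = dist ?Z ?X" "S = convex hull {?Z, ?X, pt q 0}"
      using iso S unfolding RZ unfolding 2(2) by (auto simp: insert_commute)
    ultimately have "special_at ?Z ?X ?Y S" by (intro special_at_second)
    then show ?thesis ..
  next
    case 3
    then have Rx: "p + r * b = y - r * b" using b by (simp add: algebra_simps)
    have "z - y = - (r * h)" using 3(1) by simp
    then have "?R = ?Y + (b / h) *\<^sub>R (?Z - ?Y)"
      using \<open>h > 0\<close> unfolding pt_extend R Rx by (simp add: mult.commute)
    then have "special_at ?Z ?Y ?X S"
      using \<open>h \<le> b\<close> \<open>h > 0\<close> iso S 3(2,3) by (intro special_at_third[of "b / h" ?R])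
        (auto simp: insert_commute)
    then show ?thesis ..
  next
    case 4
    then have "r * b = r * h" using b by simp
    then have "b = h" using \<open>r > 0\<close> by simp
    then have RZ: "?R = ?Z" unfolding R using 4 \<open>b = h\<close> by simp
    have "(y - p) / (y - x) * (x - y) = (y - p) / (y - x) * - (y - x)" by simp
    also have "\<dots> = - (y - p)" using \<open>x < y\<close> unfolding mult_minus_right by simp
    finally have "pt p 0 = ?Y + ((y - p) / (y - x)) *\<^sub>R (?X - ?Y)"
      unfolding pt_extend by simp
    moreover have "1 \<le> (y - p) / (y - x)" using 4(4) \<open>x < y\<close> by simp
    moreover have "dist ?Z (pt p 0) = dist ?Z ?Y" "S = convex hull {?Z, ?Y, pt p 0}"
      using iso S unfolding RZ unfolding 4(2) by (auto simp: insert_commute)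
    ultimately have "special_at ?Z ?Y ?X S" by (intro special_at_second)
    then show ?thesis ..
  qed
qed

end

section \<open>A minimal container has a flush side\<close>

text \<open>Multiplication by the complex number \<open>k + m i\<close>.\<close>

definition spiral :: "real \<Rightarrow> real \<Rightarrow> real ^ 2 \<Rightarrow> real ^ 2" where
  "spiral k m v = vector [k * v $ 1 - m * v $ 2, m * v $ 1 + k * v $ 2]"

lemma spiral_nth: "spiral k m v $ 1 = k * v $ 1 - m * v $ 2" "spiral k m v $ 2 = m * v $ 1 + k * v $ 2"
  by (simp_all add: spiral_def)

lemma det3_spiral: "det3 (spiral k m (P - w)) (spiral k m (Q - w)) (spiral k m (R - w)) = (k\<^sup>2 + m\<^sup>2) * det3 P Q R"
  by (simp add: det3_def spiral_nth) algebra

lemma dist_spiral: "dist (spiral k m (P - w)) (spiral k m (Q - w)) = sqrt (k\<^sup>2 + m\<^sup>2) * dist P Q"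
proof -
  have "(dist (spiral k m (P - w)) (spiral k m (Q - w)))\<^sup>2 = (k\<^sup>2 + m\<^sup>2) * (dist P Q)\<^sup>2"
    unfolding dist_vec2 spiral_nth vector_minus_component by algebra
  also have "\<dots> = (sqrt (k\<^sup>2 + m\<^sup>2) * dist P Q)\<^sup>2" by (simp add: power_mult_distrib)
  finally show ?thesis by simp
qed

text \<open>Otherwise the inverse similarity carries S to an isosceles triangle that still contains
  \<open>X\<close>, \<open>Y\<close>, \<open>Z\<close> but has its area divided by
  \<open>k\<^sup>2 + m\<^sup>2\<close>.\<close>

lemma minimal_no_expanding_similarity:
  assumes min: "minimum_area_isosceles_container (convex hull {X, Y, Z}) S"
    and S: "S = convex hull {P, Q, R}" and nz: "det3 P Q R \<noteq> 0" and iso: "dist P Q = dist P R"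
    and n: "k\<^sup>2 + m\<^sup>2 > 1"
  shows "\<exists>V \<in> {X, Y, Z}. spiral k m V + w \<notin> S"
proof (rule ccontr)
  assume *: "\<not> ?thesis"
  define n where "n = k\<^sup>2 + m\<^sup>2"
  \<comment> \<open>As complex numbers, \<open>(k - m i) / n\<close> is the reciprocal of
    \<open>k + m i\<close>.\<close>
  define f where "f V = spiral (k / n) (- m / n) (V - w)" for V
  have "n > 1" using n by (simp add: n_def)
  have scale: "(k / n)\<^sup>2 + (- m / n)\<^sup>2 = 1 / n"
    using \<open>n > 1\<close> by (simp add: power_divide flip: add_divide_distrib n_def) (simp add: power2_eq_square)
  have f_det: "det3 (f U) (f V) (f W) = det3 U V W / n" for U V W
    unfolding f_def det3_spiral scale by simp
  have "f (spiral k m V + w) = V" for V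
  proof -
    have "f (spiral k m V + w) $ 1 = (k * (k * V $ 1 - m * V $ 2) + m * (m * V $ 1 + k * V $ 2)) / n"
      "f (spiral k m V + w) $ 2 = (k * (m * V $ 1 + k * V $ 2) - m * (k * V $ 1 - m * V $ 2)) / n"
      by (simp_all add: f_def spiral_nth add_divide_distrib diff_divide_distrib)
    moreover have "k * (k * V $ 1 - m * V $ 2) + m * (m * V $ 1 + k * V $ 2) = n * V $ 1"
      "k * (m * V $ 1 + k * V $ 2) - m * (k * V $ 1 - m * V $ 2) = n * V $ 2"
      by (simp_all add: n_def power2_eq_square algebra_simps)
    ultimately show ?thesis
      using \<open>n > 1\<close> by (simp add: vec_eq_iff forall_2)
  qed
  moreover have "f V \<in> convex hull {f P, f Q, f R}" if "V \<in> S" for V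
    using that nz \<open>n > 1\<close> unfolding S by (simp add: in_triangle_iff f_det)
  ultimately have "V \<in> convex hull {f P, f Q, f R}" if "V \<in> {X, Y, Z}" for V
    using * that by (metis (no_types, lifting))
  moreover have "dist (f P) (f Q) = dist (f P) (f R)"
    unfolding f_def dist_spiral iso ..
  ultimately have "2 * measure lborel S \<le> \<bar>det3 (f P) (f Q) (f R)\<bar>"
    using nz \<open>n > 1\<close> by (intro minimum_area_le[OF min]) (auto simp: f_det)
  then have "\<bar>det3 P Q R\<bar> \<le> \<bar>det3 P Q R\<bar> / n"
    using \<open>n > 1\<close> by (simp add: f_det S measure_triangle)
  then show False using \<open>n > 1\<close> nz by (simp add: field_simps)
qed

lemma eventually_perturb_nonneg:
  fixes u v :: real
  assumes "u > 0 \<or> (u \<ge> 0 \<and> v \<ge> 0)"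
  shows "\<forall>\<^sub>F t in at_right 0. u + t * v \<ge> 0"
proof (cases "u > 0")
  case True
  have "((\<lambda>t. u + t * v) \<longlongrightarrow> u + 0 * v) (at_right 0)" by (intro tendsto_intros)
  then have "\<forall>\<^sub>F t in at_right 0. u + t * v > 0" using True by (intro order_tendstoD) auto
  then show ?thesis by eventually_elim simp
next
  case False
  have "\<forall>\<^sub>F t::real in at_right 0. t > 0" by (simp add: eventually_at_right_less)
  then show ?thesis by eventually_elim (use False assms in simp)
qed

lemma minimal_flush:
  assumes min: "minimum_area_isosceles_container (convex hull {A, B, C}) S"
    and S: "S = convex hull {P, Q, R}" and nz: "det3 P Q R \<noteq> 0" and iso: "dist P Q = dist P R"
  obtains V W where "V \<in> {A, B, C}" "W \<in> {A, B, C}" "V \<noteq> W"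
    "(det3 V Q R = 0 \<and> det3 W Q R = 0) \<or> (det3 P V R = 0 \<and> det3 P W R = 0) \<or>
     (det3 P Q V = 0 \<and> det3 P Q W = 0)"
proof (rule ccontr)
  assume "\<not> thesis"
  note no_flush = this that
  have not_flush: "\<not> ((det3 V Q R = 0 \<and> det3 W Q R = 0) \<or> (det3 P V R = 0 \<and> det3 P W R = 0) \<or>
     (det3 P Q V = 0 \<and> det3 P Q W = 0))" if "V \<in> {A, B, C}" "W \<in> {A, B, C}" "V \<noteq> W" for V W
    using that no_flush by blast
  define D where "D = det3 P Q R"
  \<comment> \<open>Barycentric coordinates with respect to \<open>PQR\<close>; \<open>g1\<close>,
    \<open>g2\<close>, \<open>g3\<close> below are their linear parts, that is, the rates at which
    they change under a displacement.\<close>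
  define b1 b2 b3 where "b1 V = det3 V Q R / D" and "b2 V = det3 P V R / D" and "b3 V = det3 P Q V / D" for V
  define g1 g2 g3 where "g1 v = (v $ 1 * (Q $ 2 - R $ 2) - v $ 2 * (Q $ 1 - R $ 1)) / D"
    and "g2 v = (v $ 1 * (R $ 2 - P $ 2) - v $ 2 * (R $ 1 - P $ 1)) / D"
    and "g3 v = (v $ 1 * (P $ 2 - Q $ 2) - v $ 2 * (P $ 1 - Q $ 1)) / D" for v :: "real ^ 2"
  have D: "D \<noteq> 0" using nz by (simp add: D_def)
  have b_add: "b1 (V + t *\<^sub>R v) = b1 V + t * g1 v" "b2 (V + t *\<^sub>R v) = b2 V + t * g2 v"
    "b3 (V + t *\<^sub>R v) = b3 V + t * g3 v" for V v t
    by (simp_all add: b1_def b2_def b3_def g1_def g2_def g3_def det3_def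
      add_divide_distrib[symmetric] diff_divide_distrib[symmetric] algebra_simps)
  have inS: "V \<in> S \<longleftrightarrow> 0 \<le> b1 V \<and> 0 \<le> b2 V \<and> 0 \<le> b3 V" for V
    unfolding S in_triangle_iff[OF nz] b1_def b2_def b3_def D_def ..
  have TS: "V \<in> S" if "V \<in> {A, B, C}" for V
    using min that hull_subset[of "{A, B, C}" convex]
    unfolding minimum_area_isosceles_container_def isosceles_container_def by blast
  \<comment> \<open>Selects for each side the one vertex that may touch it; if none does, any vertex
    serves.\<close>
  have ex: "\<exists>V \<in> {A, B, C}. \<forall>W \<in> {A, B, C}. W \<noteq> V \<longrightarrow> b W > 0"
    if "\<And>V W. \<lbrakk>V \<in> {A, B, C}; W \<in> {A, B, C}; b V = 0; b W = 0\<rbrakk> \<Longrightarrow> V = W"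
      "\<And>V. V \<in> {A, B, C} \<Longrightarrow> b V \<ge> 0" for b :: "real ^ 2 \<Rightarrow> real"
    using that by (metis insertI1 order_le_less)
  have nonneg: "b1 V \<ge> 0" "b2 V \<ge> 0" "b3 V \<ge> 0" if "V \<in> {A, B, C}" for V
    using TS[OF that] inS by auto
  have "V = W" if "V \<in> {A, B, C}" "W \<in> {A, B, C}" "b1 V = 0" "b1 W = 0" for V W
    using not_flush[OF that(1,2)] that(3,4) D unfolding b1_def by auto
  from ex[OF this nonneg(1)] obtain V1
    where V1: "V1 \<in> {A, B, C}" "\<forall>W \<in> {A, B, C}. W \<noteq> V1 \<longrightarrow> b1 W > 0"
    by (rule bexE)
  have "V = W" if "V \<in> {A, B, C}" "W \<in> {A, B, C}" "b2 V = 0" "b2 W = 0" for V W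
    using not_flush[OF that(1,2)] that(3,4) D unfolding b2_def by auto
  from ex[OF this nonneg(2)] obtain V2
    where V2: "V2 \<in> {A, B, C}" "\<forall>W \<in> {A, B, C}. W \<noteq> V2 \<longrightarrow> b2 W > 0"
    by (rule bexE)
  have "V = W" if "V \<in> {A, B, C}" "W \<in> {A, B, C}" "b3 V = 0" "b3 W = 0" for V W
    using not_flush[OF that(1,2)] that(3,4) D unfolding b3_def by auto
  from ex[OF this nonneg(3)] obtain V3
    where V3: "V3 \<in> {A, B, C}" "\<forall>W \<in> {A, B, C}. W \<noteq> V3 \<longrightarrow> b3 W > 0"
    by (rule bexE)
  \<comment> \<open>Rotate in the sense for which the three touching vertices have, on average, nonnegative
    velocity relative to their sides; a translation by \<open>w\<close> then equalises these velocities.\<close>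
  obtain sg where sg: "sg\<^sup>2 = 1" "g1 (spiral 0 sg V1) + g2 (spiral 0 sg V2) + g3 (spiral 0 sg V3) \<ge> 0"
  proof -
    let ?f = "\<lambda>sg. g1 (spiral 0 sg V1) + g2 (spiral 0 sg V2) + g3 (spiral 0 sg V3)"
    have "?f (-1) = - ?f 1"
      by (simp add: g1_def g2_def g3_def spiral_nth minus_divide_left[symmetric] diff_divide_distrib add_divide_distrib)
    then have "?f 1 \<ge> 0 \<or> ?f (-1) \<ge> 0" by linarith
    then show thesis using that[of 1] that[of "-1"] by auto
  qed
  define c1 c2 c3 where "c1 = g1 (spiral 0 sg V1)" and "c2 = g2 (spiral 0 sg V2)" and "c3 = g3 (spiral 0 sg V3)"
  define c where "c = (c1 + c2 + c3) / 3"
  have "c \<ge> 0" using sg(2) by (simp add: c_def c1_def c2_def c3_def)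
  \<comment> \<open>The coefficients sum to zero, and the linear parts send such a combination of
    \<open>P\<close>, \<open>Q\<close>, \<open>R\<close> back to its coefficients.\<close>
  define w where "w = (c - c1) *\<^sub>R P + (c - c2) *\<^sub>R Q + (c - c3) *\<^sub>R R"
  have sum0: "c3 = 3 * c - c1 - c2" by (simp add: c_def field_simps)
  have g_w: "g1 w = c - c1" "g2 w = c - c2" "g3 w = c - c3"
  proof -
    have "D * g1 w = w $ 1 * (Q $ 2 - R $ 2) - w $ 2 * (Q $ 1 - R $ 1)"
      "D * g2 w = w $ 1 * (R $ 2 - P $ 2) - w $ 2 * (R $ 1 - P $ 1)"
      "D * g3 w = w $ 1 * (P $ 2 - Q $ 2) - w $ 2 * (P $ 1 - Q $ 1)"
      using D by (simp_all add: g1_def g2_def g3_def)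
    then have "D * g1 w = D * (c - c1)" "D * g2 w = D * (c - c2)" "D * g3 w = D * (c - c3)"
      unfolding w_def sum0 D_def det3_def by (simp_all add: algebra_simps)
    then show "g1 w = c - c1" "g2 w = c - c2" "g3 w = c - c3" using D by auto
  qed
  have g_add: "g1 (u + v) = g1 u + g1 v" "g2 (u + v) = g2 u + g2 v" "g3 (u + v) = g3 u + g3 v" for u v
    by (simp_all add: g1_def g2_def g3_def algebra_simps add_divide_distrib diff_divide_distrib)
  have ev: "\<forall>\<^sub>F t in at_right 0. V + t *\<^sub>R (spiral 0 sg V + w) \<in> S" if V: "V \<in> {A, B, C}" for V
  proof -
    note nn = nonneg[OF V]
    have "b1 V > 0 \<or> (b1 V \<ge> 0 \<and> g1 (spiral 0 sg V + w) \<ge> 0)"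
      using V1(2)[rule_format, OF V] nn \<open>c \<ge> 0\<close> by (cases "V = V1") (auto simp: g_add g_w c1_def)
    moreover have "b2 V > 0 \<or> (b2 V \<ge> 0 \<and> g2 (spiral 0 sg V + w) \<ge> 0)"
      using V2(2)[rule_format, OF V] nn \<open>c \<ge> 0\<close> by (cases "V = V2") (auto simp: g_add g_w c2_def)
    moreover have "b3 V > 0 \<or> (b3 V \<ge> 0 \<and> g3 (spiral 0 sg V + w) \<ge> 0)"
      using V3(2)[rule_format, OF V] nn \<open>c \<ge> 0\<close> by (cases "V = V3") (auto simp: g_add g_w c3_def)
    ultimately show ?thesis
      unfolding inS b_add by (intro eventually_conj eventually_perturb_nonneg)
  qed
  have "\<forall>\<^sub>F t::real in at_right 0. t > 0" by (simp add: eventually_at_right_less)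
  with ev[of A] ev[of B] ev[of C]
  have "\<forall>\<^sub>F t in at_right 0. t > 0 \<and> (\<forall>V \<in> {A, B, C}. V + t *\<^sub>R (spiral 0 sg V + w) \<in> S)"
    by simp (intro eventually_conj)
  then obtain t where t: "t > 0" "\<And>V. V \<in> {A, B, C} \<Longrightarrow> V + t *\<^sub>R (spiral 0 sg V + w) \<in> S"
    using eventually_happens[of _ "at_right (0::real)"] by auto
  have "V + t *\<^sub>R (spiral 0 sg V + w) = spiral 1 (t * sg) V + t *\<^sub>R w" for V
    by (simp add: vec_eq_iff forall_2 spiral_nth algebra_simps)
  moreover have "1\<^sup>2 + (t * sg)\<^sup>2 > 1" using t(1) sg(1) by (simp add: power_mult_distrib)
  ultimately show False
    using minimal_no_expanding_similarity[OF min S nz iso] t(2) by metis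
qed

section \<open>Every minimal container is special\<close>

lemma special_if_flush_leg:
  assumes min: "minimum_area_isosceles_container (convex hull {X, Y, Z}) S"
    and S: "S = convex hull {P, Q, R}" and nz: "det3 P Q R \<noteq> 0" and iso: "dist P Q = dist P R"
    and T: "det3 X Y Z \<noteq> 0" and flush: "det3 P Q X = 0" "det3 P Q Y = 0"
  shows "\<exists>X' Y' Z'. {X', Y', Z'} = {X, Y, Z} \<and> special_at X' Y' Z' S"
proof -
  obtain U c d e l a b where fr: "frame c d e" and lb: "l > 0" "b > 0"
    and P: "P = frame.pt U c d e 0 0" and Q: "Q = frame.pt U c d e l 0" and R: "R = frame.pt U c d e a b"
    using frame_exists[OF nz] .
  interpret frame U c d e by (rule fr)
  obtain x x' y y' z h where X': "X = pt x x'" and Y': "Y = pt y y'" and Z: "Z = pt z h" using ptE by metis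
  have "x' = 0" "y' = 0"
    using flush lb(1) unfolding P Q X' Y' det3_pt by auto
  then have X: "X = pt x 0" and Y: "Y = pt y 0" using X' Y' by auto
  \<comment> \<open>The cotangents of the angles at \<open>Q\<close> and \<open>P\<close>, read off
    from the coordinates of \<open>R\<close>; equality of the legs becomes the relation between them
    proved below.\<close>
  define s t where "s = (l - a) / b" and "t = a / b"
  have l2: "l\<^sup>2 = a\<^sup>2 + b\<^sup>2"
    using iso lb unfolding P Q R dist_pt by simp
  then have "a\<^sup>2 < l\<^sup>2" using lb by simp
  then have "a < l" using lb by (simp add: power2_less_imp_less)
  then have "s > 0" using lb by (simp add: s_def)
  have "s + t > 0" "height 0 l s t = b"
    using lb by (simp_all add: s_def t_def height_def flip: add_divide_distrib)
  then have R': "R = tri_top 0 l s t" using lb by (simp add: tri_top_def R t_def)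
  have t: "t = (1 / s - s) / 2"
  proof -
    have "2 * s * t = 1 - s\<^sup>2"
      using l2 lb by (simp add: s_def t_def field_simps power2_eq_square)
    then show ?thesis using \<open>s > 0\<close> by (simp add: field_simps power2_eq_square)
  qed
  have "X \<in> S" "Y \<in> S" "Z \<in> S"
    using min hull_subset[of "{X, Y, Z}" convex]
    unfolding minimum_area_isosceles_container_def isosceles_container_def by auto
  then have in_S: "0 \<le> x" "x \<le> l" "0 \<le> y" "y \<le> l" "0 \<le> h" "z + s * h \<le> l" "0 \<le> z - t * h"
    unfolding S P Q R' X Y Z in_tri_iff[OF \<open>s + t > 0\<close> lb(1)] by auto
  have "x \<noteq> y" "h \<noteq> 0" using T unfolding X Y Z det3_pt by auto
  with in_S have "h > 0" by simp
  consider "x < y" | "y < x" using \<open>x \<noteq> y\<close> by linarith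
  then show ?thesis
  proof cases
    case 1
    from special_leg[OF min[unfolded X Y Z] S[unfolded P Q R' t] \<open>s > 0\<close> lb(1) 1 \<open>h > 0\<close>
        in_S(1,4,6) in_S(7)[unfolded t]]
    show ?thesis unfolding X Y Z by blast
  next
    case 2
    have "minimum_area_isosceles_container (convex hull {Y, X, Z}) S"
      using min by (simp add: insert_commute)
    from special_leg[OF this[unfolded X Y Z] S[unfolded P Q R' t] \<open>s > 0\<close> lb(1) 2 \<open>h > 0\<close>
        in_S(3,2,6) in_S(7)[unfolded t]]
    show ?thesis unfolding X Y Z by blast
  qed
qed

lemma special_if_flush_base:
  assumes min: "minimum_area_isosceles_container (convex hull {X, Y, Z}) S"
    and S: "S = convex hull {P, Q, R}" and nz: "det3 P Q R \<noteq> 0" and iso: "dist P Q = dist P R"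
    and T: "det3 X Y Z \<noteq> 0" and flush: "det3 X Q R = 0" "det3 Y Q R = 0"
  shows "\<exists>X' Y' Z'. {X', Y', Z'} = {X, Y, Z} \<and> special_at X' Y' Z' S"
proof -
  have cyc: "det3 Q R V = det3 V Q R" for V by (simp add: det3_def algebra_simps)
  have nz': "det3 Q R P \<noteq> 0" using nz by (simp add: cyc)
  obtain U c d e l a b where fr: "frame c d e" and lb: "l > 0" "b > 0"
    and Q: "Q = frame.pt U c d e 0 0" and R: "R = frame.pt U c d e l 0" and P: "P = frame.pt U c d e a b"
    using frame_exists[OF nz'] .
  interpret frame U c d e by (rule fr)
  obtain x x' y y' z h where X': "X = pt x x'" and Y': "Y = pt y y'" and Z: "Z = pt z h" using ptE by metis
  have "x' = 0" "y' = 0"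
    using flush[folded cyc] lb(1) unfolding Q R X' Y' det3_pt by auto
  then have X: "X = pt x 0" and Y: "Y = pt y 0" using X' Y' by auto
  define r where "r = a / b"
  have "a\<^sup>2 = (a - l)\<^sup>2"
    using iso unfolding P Q R dist_pt by simp
  then have "l * (l - 2 * a) = 0" by algebra
  then have l: "l = 2 * a" using lb by auto
  then have "r > 0" using lb by (simp add: r_def)
  have "height 0 l r r = b"
    using lb l by (simp add: r_def height_def)
  then have P': "P = tri_top 0 l r r" using lb by (simp add: tri_top_def P r_def)
  have S': "S = convex hull {Q, R, P}" using S by (simp add: insert_commute)
  have "X \<in> S" "Y \<in> S" "Z \<in> S"
    using min hull_subset[of "{X, Y, Z}" convex]
    unfolding minimum_area_isosceles_container_def isosceles_container_def by auto
  moreover have "r + r > 0" using \<open>r > 0\<close> by simp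
  ultimately have in_S: "0 \<le> x" "x \<le> l" "0 \<le> y" "y \<le> l" "0 \<le> h" "z + r * h \<le> l" "0 \<le> z - r * h"
    unfolding S' Q R P' X Y Z in_tri_iff[OF \<open>r + r > 0\<close> lb(1)] by auto
  have "x \<noteq> y" "h \<noteq> 0" using T unfolding X Y Z det3_pt by auto
  with in_S have "h > 0" by simp
  consider "x < y" | "y < x" using \<open>x \<noteq> y\<close> by linarith
  then show ?thesis
  proof cases
    case 1
    from special_base[OF min[unfolded X Y Z] S'[unfolded Q R P'] \<open>r > 0\<close> lb(1) 1 \<open>h > 0\<close>
        in_S(1,4,6,7)]
    show ?thesis unfolding X Y Z by blast
  next
    case 2
    have "minimum_area_isosceles_container (convex hull {Y, X, Z}) S"
      using min by (simp add: insert_commute)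
    from special_base[OF this[unfolded X Y Z] S'[unfolded Q R P'] \<open>r > 0\<close> lb(1) 2 \<open>h > 0\<close>
        in_S(3,2,6,7)]
    show ?thesis unfolding X Y Z by blast
  qed
qed

lemma minimal_special_at:
  assumes T: "\<not> collinear {A, B, C}"
    and min: "minimum_area_isosceles_container (convex hull {A, B, C}) S"
  shows "\<exists>X Y Z. {X, Y, Z} = {A, B, C} \<and> special_at X Y Z S"
proof -
  have "isosceles_triangle S"
    using min by (simp add: minimum_area_isosceles_container_def isosceles_container_def)
  then obtain P Q R where PQR: "\<not> collinear {P, Q, R}" "S = convex hull {P, Q, R}"
    "dist P Q = dist P R \<or> dist Q P = dist Q R \<or> dist R P = dist R Q"
    unfolding isosceles_triangle_def by blast
  \<comment> \<open>Relabelling makes \<open>P\<close> the apex, so that \<open>QR\<close> is the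
    base and the flush side is treated as base or leg accordingly.\<close>
  have "\<exists>P Q R. \<not> collinear {P, Q, R} \<and> S = convex hull {P, Q, R} \<and> dist P Q = dist P R"
    using PQR(3)
  proof (elim disjE)
    assume "dist Q P = dist Q R"
    with PQR(1,2) show ?thesis
      by (intro exI[of _ Q] exI[of _ P] exI[of _ R]) (simp add: insert_commute)
  next
    assume "dist R P = dist R Q"
    with PQR(1,2) show ?thesis
      by (intro exI[of _ R] exI[of _ P] exI[of _ Q]) (simp add: insert_commute)
  qed (use PQR in blast)
  then obtain P Q R where nz: "det3 P Q R \<noteq> 0" and S: "S = convex hull {P, Q, R}"
    and iso: "dist P Q = dist P R"
    unfolding collinear_iff_det3 by blast
  have swap: "det3 P R V = - det3 P V R" for V by (simp add: det3_def algebra_simps)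
  have S': "S = convex hull {P, R, Q}" using S by (simp add: insert_commute)
  obtain X Y where XY: "X \<in> {A, B, C}" "Y \<in> {A, B, C}" "X \<noteq> Y"
    and flush: "(det3 X Q R = 0 \<and> det3 Y Q R = 0) \<or> (det3 P X R = 0 \<and> det3 P Y R = 0) \<or>
     (det3 P Q X = 0 \<and> det3 P Q Y = 0)"
    using minimal_flush[OF min S nz iso] .
  have "{X, Y, A} = {A, B, C} \<or> {X, Y, B} = {A, B, C} \<or> {X, Y, C} = {A, B, C}"
    using XY by auto
  then obtain Z where Z: "{X, Y, Z} = {A, B, C}" by blast
  have T': "det3 X Y Z \<noteq> 0" using T unfolding Z[symmetric] collinear_iff_det3 .
  note min' = min[folded Z]
  from flush show ?thesis
  proof (elim disjE conjE)
    assume "det3 X Q R = 0" "det3 Y Q R = 0"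
    from special_if_flush_base[OF min' S nz iso T' this] show ?thesis unfolding Z .
  next
    assume "det3 P X R = 0" "det3 P Y R = 0"
    then have "det3 P R X = 0" "det3 P R Y = 0" by (simp_all add: swap)
    from special_if_flush_leg[OF min' S' _ iso[symmetric] T' this] nz
    show ?thesis unfolding Z by (simp add: swap)
  next
    assume "det3 P Q X = 0" "det3 P Q Y = 0"
    from special_if_flush_leg[OF min' S nz iso T' this] show ?thesis unfolding Z .
  qed
qed

text \<open>Adds to each kind the side comparison that \<open>k \<ge> 1\<close> entails. For the
  first two, \<open>Z\<close> lies on a chord of the disc about \<open>X\<close> of radius
  \<open>|XY|\<close>. For the third, \<open>|PX| = (k - 1) |XY|\<close> and
  \<open>|PZ| = |PY| = k |XY|\<close>, so the triangle inequality bounds \<open>|XZ|\<close> from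
  below.\<close>

lemma special_atE:
  assumes "special_at X Y Z S"
  obtains (first) k where "k \<ge> 1" "dist X (X + k *\<^sub>R (Z - X)) = dist X Y"
      "S = convex hull {X, Y, X + k *\<^sub>R (Z - X)}" "dist X Z \<le> dist X Y"
    | (second) k where "k \<ge> 1" "dist X (Y + k *\<^sub>R (Z - Y)) = dist X Y"
      "S = convex hull {X, Y, Y + k *\<^sub>R (Z - Y)}" "dist X Z \<le> dist X Y"
    | (third) k where "k \<ge> 1" "dist (Y + k *\<^sub>R (X - Y)) Y = dist (Y + k *\<^sub>R (X - Y)) Z"
      "S = convex hull {Y + k *\<^sub>R (X - Y), Y, Z}" "dist X Y \<le> dist X Z"
proof -
  obtain k where k: "k \<ge> 1" and disj:
    "dist X (X + k *\<^sub>R (Z - X)) = dist X Y \<and> S = convex hull {X, Y, X + k *\<^sub>R (Z - X)} \<or>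
     dist X (Y + k *\<^sub>R (Z - Y)) = dist X Y \<and> S = convex hull {X, Y, Y + k *\<^sub>R (Z - Y)} \<or>
     dist (Y + k *\<^sub>R (X - Y)) Y = dist (Y + k *\<^sub>R (X - Y)) Z \<and> S = convex hull {Y + k *\<^sub>R (X - Y), Y, Z}"
    using assms unfolding special_at_def Let_def by blast
  have ball: "dist X Z \<le> dist X Y" if "dist X (V + k *\<^sub>R (Z - V)) = dist X Y" "V \<in> {X, Y}" for V
  proof -
    have "Z \<in> cball X (dist X Y)"
      by (rule in_convex_extend[OF k refl, where X = V]) (use that in auto)
    then show ?thesis by simp
  qed
  from disj show thesis
  proof (elim disjE conjE)
    let ?P = "Y + k *\<^sub>R (X - Y)"
    assume *: "dist ?P Y = dist ?P Z" "S = convex hull {?P, Y, Z}"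
    have "?P - X = (k - 1) *\<^sub>R (X - Y)" by (simp add: algebra_simps)
    then have "dist ?P X = (k - 1) * dist X Y" using k by (simp add: dist_norm)
    moreover have "dist ?P Y = k * dist X Y" using k by (simp add: dist_norm)
    ultimately have "dist X Y \<le> dist X Z"
      using * dist_triangle[of ?P Z X] by (simp add: algebra_simps)
    from third[OF k * this] show thesis .
  next
    assume *: "dist X (X + k *\<^sub>R (Z - X)) = dist X Y" "S = convex hull {X, Y, X + k *\<^sub>R (Z - X)}"
    from first[OF k * ball[OF *(1)]] show thesis by simp
  next
    assume *: "dist X (Y + k *\<^sub>R (Z - Y)) = dist X Y" "S = convex hull {X, Y, Y + k *\<^sub>R (Z - Y)}"
    from second[OF k * ball[OF *(1)]] show thesis by simp
  qed
qed

lemma in_ray: "t \<ge> 0 \<Longrightarrow> X + t *\<^sub>R (Y - X) \<in> ray X Y"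
  by (auto simp: ray_def)

lemma in_perpendicular_bisector:
  assumes "dist P X = dist P Y"
  shows "P \<in> perpendicular_bisector X Y"
proof -
  have "(P - X) \<bullet> (P - X) = (P - Y) \<bullet> (P - Y)"
    using assms by (metis dist_norm dot_square_norm)
  then have "(P - midpoint X Y) \<bullet> (Y - X) = 0"
    by (simp add: midpoint_def inner_diff_left inner_diff_right inner_add_left inner_commute algebra_simps)
  then show ?thesis by (simp add: perpendicular_bisector_def orthogonal_def)
qed

lemma in_affine_hull_2: "Y + k *\<^sub>R (X - Y) \<in> affine hull {X, Y}"
  unfolding affine_hull_2
  by (intro CollectI exI[of _ k] exI[of _ "1 - k"]) (simp add: algebra_simps)

theorem theorem1p3:
  fixes A B C :: "real ^ 2" and a b c :: real and S :: "(real ^ 2) set"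
  assumes "\<not> collinear {A, B, C}"
    and "a = dist B C" and "b = dist A C" and "c = dist A B"
    and "a < b" and "b < c"
    and "minimum_area_isosceles_container (convex hull {A, B, C}) S"
  shows "special_container_first_kind A B C S \<or>
         special_container_second_kind A B C S \<or>
         special_container_third_kind A B C S"
proof -
  have T: "convex hull {A, B, C} \<subseteq> S"
    using assms(7) by (simp add: minimum_area_isosceles_container_def isosceles_container_def)
  have "A \<noteq> B" "A \<noteq> C" "B \<noteq> C"
    using assms(1) unfolding collinear_iff_det3 det3_def by auto
  note less = assms(5,6)[unfolded assms(2-4)]
  obtain X Y Z where XYZ: "{X, Y, Z} = {A, B, C}" and sp: "special_at X Y Z S"
    using minimal_special_at[OF assms(1,7)] by blast
  have "A \<in> {X, Y, Z}" "B \<in> {X, Y, Z}" "C \<in> {X, Y, Z}" unfolding XYZ by simp_all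
  then have perm: "(X, Y, Z) \<in> {(A, B, C), (A, C, B), (B, A, C), (B, C, A), (C, A, B), (C, B, A)}"
    using \<open>A \<noteq> B\<close> \<open>A \<noteq> C\<close> \<open>B \<noteq> C\<close> by auto
  from sp show ?thesis
  proof (cases rule: special_atE)
    case (first k)
    \<comment> \<open>At each apex \<open>X\<close> the longer side must be the leg
      \<open>XY\<close>; the three survivors give \<open>ABC'\<close>, \<open>ABC''\<close> and
      \<open>AB'C\<close>.\<close>
    have "(X, Y, Z) \<in> {(A, B, C), (B, A, C), (C, A, B)}"
      using perm first(4) less by (auto simp: dist_commute)
    moreover have "X + k *\<^sub>R (Z - X) \<in> ray X Z" using first(1) by (simp add: in_ray)
    ultimately have "special_container_first_kind A B C S"
      using first(2,3) unfolding special_container_first_kind_def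
      by (auto simp: dist_commute insert_commute)
    then show ?thesis ..
  next
    case (second k)
    have "(X, Y, Z) \<in> {(A, B, C), (B, A, C), (C, A, B)}"
      using perm second(4) less by (auto simp: dist_commute)
    moreover have "Y + k *\<^sub>R (Z - Y) \<in> ray Y Z" using second(1) by (simp add: in_ray)
    moreover have "Y + k *\<^sub>R (Z - Y) \<noteq> Y" using perm second(1) \<open>A \<noteq> B\<close> \<open>A \<noteq> C\<close> \<open>B \<noteq> C\<close> by auto
    ultimately have "special_container_second_kind A B C S"
      using second(2,3) unfolding special_container_second_kind_def
      by (auto simp: dist_commute insert_commute)
    then show ?thesis by blast
  next
    case (third k)
    let ?P = "Y + k *\<^sub>R (X - Y)"
    \<comment> \<open>Now \<open>XY\<close> is the shorter side at \<open>X\<close>, and the base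
      \<open>YZ\<close> is \<open>BC\<close>, \<open>AC\<close> or \<open>AB\<close> in this
      order.\<close>
    have "(X, Y, Z) \<in> {(A, C, B), (B, C, A), (C, B, A)}"
      using perm third(4) less by (auto simp: dist_commute)
    moreover have "?P \<in> perpendicular_bisector Y Z" "?P \<in> perpendicular_bisector Z Y"
      using third(2) by (simp_all add: in_perpendicular_bisector)
    moreover have "?P \<in> affine hull {X, Y}" by (rule in_affine_hull_2)
    ultimately have "special_container_third_kind A B C S"
      using third(3) T unfolding special_container_third_kind_def
      by (auto simp: insert_commute)
    then show ?thesis by blast
  qed
qed

end
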